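(* Let $X,Y\subset\mathbb R^2$ be two nonempty bounded open sets with $Y$ convex, and let $f:X\to\mathbb R_+$, $g:Y\to\mathbb R_+$ be probability densities such that for some $\lambda>0$ one has $\frac1\lambda\le f\le\lambda$ a.e. on $X$ and $\frac1\lambda\le g\le\lambda$ a.e. on $Y$. Then there is a unique (up to an additive constant) convex lower semicontinuous function $\tilde u:\mathbb R^2\to\mathbb R\cup\{+\infty\}$ which is a Brenier solution for the transport of $\mu$ to $\nu$ and which satisfies $\partial\tilde u(\mathbb R^2)=\overline Y$. Moreover, $\tilde u\in C^1(\mathbb R^2)$.
   Context: $\mu$ and $\nu$ denote the probability measures on $\mathbb R^2$ with densities $f$ (extended by $0$ outside $X$) and $g$ (extended by $0$ outside $Y$). A convex lower semicontinuous function $u:\mathbb R^2\to\mathbb R\cup\{+\infty\}$ is a Brenier solution (of the Monge-Ampère problem $\det(\nabla^2u)=f/(g\circ\nabla u)$ on $X$, $\nabla u(X)\subset\overline Y$, $u$ convex) if $(\nabla u)_\sharp\mu=\nu$. $\partial u(x)$ is the convex subdifferential of $u$ at $x$ and $\partial u(\mathbb R^2)=\bigcup_{x\in\mathbb R^2}\partial u(x)$. *)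

theory Defs
  imports "HOL-Analysis.Analysis"
begin

text \<open>Extended-valued functions have type \<open>'a \<Rightarrow> ereal\<close>; the value \<open>-\<infinity>\<close>, which \<open>ereal\<close>
  admits, is excluded explicitly. In \<open>ereal\<close>, \<open>0 * \<infinity> = 0\<close>, which makes the convexity
  inequality a triviality at the two endpoints.\<close>

definition convex_ereal :: "('a::real_vector \<Rightarrow> ereal) \<Rightarrow> bool" where
  "convex_ereal u \<longleftrightarrow> (\<forall>x. u x \<noteq> -\<infinity>) \<and>
     (\<forall>x y s t. 0 \<le> s \<longrightarrow> 0 \<le> t \<longrightarrow> s + t = 1 \<longrightarrow>
        u (s *\<^sub>R x + t *\<^sub>R y) \<le> ereal s * u x + ereal t * u y)"

definition lsc :: "('a::topological_space \<Rightarrow> ereal) \<Rightarrow> bool" where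
  "lsc u \<longleftrightarrow> (\<forall>x. u x \<le> Liminf (at x) u)"

text \<open>Empty outside the effective domain of \<open>u\<close>.\<close>

definition subdifferential :: "('a::real_inner \<Rightarrow> ereal) \<Rightarrow> 'a \<Rightarrow> 'a set" where
  "subdifferential u x = {p. \<bar>u x\<bar> \<noteq> \<infinity> \<and> (\<forall>y. u x + ereal (p \<bullet> (y - x)) \<le> u y)}"

text \<open>Finiteness near the point is needed because \<open>real_of_ereal \<infinity> = 0\<close>.\<close>

definition has_gradient :: "('a::real_inner \<Rightarrow> ereal) \<Rightarrow> 'a \<Rightarrow> 'a \<Rightarrow> bool" where
  "has_gradient u x p \<longleftrightarrow>
     (\<forall>\<^sub>F y in nhds x. \<bar>u y\<bar> \<noteq> \<infinity>) \<and> GDERIV (\<lambda>y. real_of_ereal (u y)) x :> p"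

text \<open>Off the differentiability set the value is one unspecified vector, independent of
  the point.\<close>

definition gradient :: "('a::real_inner \<Rightarrow> ereal) \<Rightarrow> 'a \<Rightarrow> 'a" where
  "gradient u x = (THE p. has_gradient u x p)"

definition C1_ereal :: "('a::real_inner \<Rightarrow> ereal) \<Rightarrow> bool" where
  "C1_ereal u \<longleftrightarrow> (\<forall>x. \<exists>p. has_gradient u x p) \<and> continuous_on UNIV (gradient u)"

definition prob_density_on :: "'a::euclidean_space set \<Rightarrow> ('a \<Rightarrow> real) \<Rightarrow> bool" where
  "prob_density_on S f \<longleftrightarrow> f \<in> borel_measurable (lebesgue_on S) \<and> (\<forall>x\<in>S. 0 \<le> f x) \<and>
     (\<integral>\<^sup>+x. ennreal (f x) \<partial>lebesgue_on S) = 1"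

text \<open>The Borel measure whose density is \<open>f\<close> extended by \<open>0\<close> outside \<open>S\<close>. Since \<open>f\<close> is only
  assumed Lebesgue measurable, the density is taken with respect to \<open>lebesgue\<close>, and the
  image under the identity restricts the result to the Borel sigma-algebra.\<close>

definition density_measure :: "'a::euclidean_space set \<Rightarrow> ('a \<Rightarrow> real) \<Rightarrow> 'a measure" where
  "density_measure S f = distr (density lebesgue (\<lambda>x. ennreal (f x) * indicator S x)) borel (\<lambda>x. x)"

text \<open>The gradient of \<open>u\<close> has to exist almost everywhere for \<open>\<mu>\<close>. Measurability is
  required explicitly because \<open>distr\<close> is only the image measure for measurable maps.\<close>

definition brenier_solution ::
  "'a::euclidean_space measure \<Rightarrow> 'a measure \<Rightarrow> ('a \<Rightarrow> ereal) \<Rightarrow> bool" where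
  "brenier_solution \<mu> \<nu> u \<longleftrightarrow> convex_ereal u \<and> lsc u \<and>
     (AE x in \<mu>. \<exists>p. has_gradient u x p) \<and>
     gradient u \<in> measurable \<mu> borel \<and> distr \<mu> borel (gradient u) = \<nu>"

end

theory Submission
  imports Defs "HOL-Complex_Analysis.Great_Picard" "HOL-Probability.Probability_Measure"
begin

text \<open>
  Write \<open>S\<close> and \<open>K\<close> for the closures of \<open>X\<close> and \<open>Y\<close>.

  Existence comes from Kantorovich duality. The potential is \<open>u x = (SUP y\<in>K. x \<bullet> y - \<phi> y)\<close>, where
  \<open>\<phi>\<close> minimises the sum of the integrals of \<open>\<phi>\<close> against \<open>\<nu>\<close> and of its Legendre transform against
  \<open>\<mu>\<close> (\<open>cost_minimizer\<close>). Since the supremum runs over the bounded convex set \<open>K\<close>, the function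
  \<open>u\<close> is finite on the whole plane and all its slopes lie in \<open>K\<close>. Varying \<open>\<phi>\<close> on a closed set \<open>C\<close>
  shows that \<open>C\<close> has at most as much \<open>\<nu>\<close>-mass as the set of points of \<open>S\<close> with a slope in \<open>C\<close> has
  \<open>\<mu>\<close>-mass (\<open>optimal_potential\<close>).

  Regularity is deduced from this inequality before the gradient is known to exist anywhere.
  With the bounds on the densities it says that slopes in \<open>Y\<close> filling a certain area are attained on
  a subset of \<open>S\<close> of comparable area, a weak form of an upper bound for the Monge-Ampere measure. In
  two dimensions such a bound excludes a segment of slopes at one point, whether or not the point
  is in \<open>X\<close> and even if the segment lies in the boundary of \<open>Y\<close> (\<open>subgrad_unique_plane\<close>). So every
  subdifferential is a singleton, which gives \<open>C^1\<close> regularity (\<open>unique_subgrad_imp_C1\<close>), and the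
  inequality on closed sets turns into equality of \<open>\<nu>\<close> with the image of \<open>\<mu>\<close> under the gradient
  (\<open>pushforward_eqI\<close>). As \<open>\<nu>\<close> charges every neighbourhood of every point of \<open>K\<close> and \<open>S\<close> is compact,
  every point of \<open>K\<close> is a slope of \<open>u\<close>.

  For uniqueness, a solution \<open>v\<close> whose slopes fill exactly \<open>K\<close> is finite everywhere
  (\<open>subdifferential_nonempty\<close>). Two convex functions whose gradients carry \<open>\<mu>\<close> to \<open>\<nu>\<close> share their
  gradients \<open>\<mu>\<close>-almost everywhere (\<open>transport_gradients_agree\<close>), and by compactness each point of
  \<open>K\<close> is a slope of both at a common point of \<open>S\<close>. This does not settle the matter on the side of
  \<open>X\<close>, which may be disconnected, but \<open>K\<close> is convex: the conjugates of \<open>u\<close> and \<open>v\<close> differ by a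
  constant on \<open>K\<close>, and therefore so do \<open>u\<close> and \<open>v\<close>, which are the suprema of the affine functions
  with slopes in \<open>K\<close> determined by their conjugates (\<open>common_subgrads_imp_diff_const\<close>).
\<close>

section \<open>Legendre transforms over a bounded set\<close>

text \<open>The supremum is taken over \<open>K\<close> only: with \<open>\<phi>\<close> bounded on a bounded \<open>K\<close> the transform is
  finite and Lipschitz on the whole space, and its slopes are confined to the closed convex hull
  of \<open>K\<close>.\<close>

definition legendre :: "'a::real_inner set \<Rightarrow> ('a \<Rightarrow> real) \<Rightarrow> 'a \<Rightarrow> real" where
  "legendre K \<phi> x = (SUP y\<in>K. x \<bullet> y - \<phi> y)"

lemma legendre_upper:
  assumes "bounded K" "bounded (\<phi> ` K)" "y \<in> K"
  shows "x \<bullet> y - \<phi> y \<le> legendre K \<phi> x"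
proof -
  obtain a where a: "\<And>y. y \<in> K \<Longrightarrow> norm y \<le> a" using assms(1) by (auto simp: bounded_iff)
  obtain b where b: "\<And>y. y \<in> K \<Longrightarrow> \<bar>\<phi> y\<bar> \<le> b" using assms(2) by (auto simp: bounded_iff)
  have "bdd_above ((\<lambda>y. x \<bullet> y - \<phi> y) ` K)"
  proof (rule bdd_aboveI2)
    fix y assume "y \<in> K"
    then have "x \<bullet> y \<le> norm x * a"
      using norm_cauchy_schwarz[of x y] a[of y] by (meson mult_left_mono norm_ge_zero order_trans)
    then show "x \<bullet> y - \<phi> y \<le> norm x * a + b" using b[OF \<open>y \<in> K\<close>] by linarith
  qed
  then show ?thesis unfolding legendre_def using cSUP_upper assms(3) by fast
qed

lemma legendre_least:
  assumes "K \<noteq> {}" "\<And>y. y \<in> K \<Longrightarrow> x \<bullet> y - \<phi> y \<le> c"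
  shows "legendre K \<phi> x \<le> c"
  unfolding legendre_def by (rule cSUP_least) (use assms in auto)

lemma legendre_Lipschitz:
  assumes "K \<noteq> {}" "K \<subseteq> cball 0 R" "bounded (\<phi> ` K)" "0 \<le> R"
  shows "R-lipschitz_on UNIV (legendre K \<phi>)"
proof -
  have le: "legendre K \<phi> x \<le> legendre K \<phi> z + R * dist x z" for x z
  proof (rule legendre_least[OF assms(1)])
    fix y assume y: "y \<in> K"
    have "bounded K" using assms(2) bounded_cball bounded_subset by blast
    have "(x - z) \<bullet> y \<le> dist x z * R"
      using norm_cauchy_schwarz[of "x - z" y] y assms(2)
      by (smt (verit) dist_norm mem_cball_0 mult_left_mono norm_ge_zero subsetD)
    then show "x \<bullet> y - \<phi> y \<le> legendre K \<phi> z + R * dist x z"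
      using legendre_upper[OF \<open>bounded K\<close> assms(3) y, of z] by (simp add: algebra_simps)
  qed
  show ?thesis
    unfolding lipschitz_on_def dist_real_def
  proof (intro conjI ballI)
    fix x y show "\<bar>legendre K \<phi> x - legendre K \<phi> y\<bar> \<le> R * dist x y"
      using le[of x y] le[of y x] by (simp add: dist_commute abs_le_iff)
  qed (fact assms)
qed

lemma continuous_on_legendre:
  assumes "K \<noteq> {}" "bounded K" "bounded (\<phi> ` K)"
  shows "continuous_on A (legendre K \<phi>)"
proof -
  obtain R where "0 < R" "K \<subseteq> cball 0 R"
    using assms(2) bounded_pos by (metis mem_cball_0 subsetI)
  then show ?thesis
    using legendre_Lipschitz[of K R \<phi>] assms lipschitz_on_continuous_on continuous_on_subset
    by (metis less_imp_le subset_UNIV)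
qed

lemma legendre_attained:
  assumes "compact K" "K \<noteq> {}" "continuous_on K \<phi>"
  obtains y where "y \<in> K" "legendre K \<phi> x = x \<bullet> y - \<phi> y"
proof -
  have "continuous_on K (\<lambda>y. x \<bullet> y - \<phi> y)" by (intro continuous_intros assms)
  then obtain y where y: "y \<in> K" "\<And>z. z \<in> K \<Longrightarrow> x \<bullet> z - \<phi> z \<le> x \<bullet> y - \<phi> y"
    using continuous_attains_sup[OF assms(1,2)] by blast
  have "legendre K \<phi> x = x \<bullet> y - \<phi> y"
    using y legendre_least[OF assms(2), of x \<phi>]
      legendre_upper[OF compact_imp_bounded[OF assms(1)] compact_imp_bounded[OF compact_continuous_image[OF assms(3,1)]] y(1), of x]
    by (meson order_antisym)
  then show thesis using that y by blast
qed

section \<open>The dual problem and its optimality condition\<close>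

text \<open>Kantorovich's dual problem for the cost \<open>- x \<bullet> y\<close> between \<open>M\<close>, carried by \<open>S\<close>, and \<open>N\<close>,
  carried by \<open>K\<close>. Only the potential on the target side is an unknown; the potential on the source
  side is its Legendre transform, the smallest function compatible with it.\<close>

locale dual_problem =
  M: prob_space M + N: prob_space N for M N :: "'a::euclidean_space measure" +
  fixes S K :: "'a set"
  assumes sets_M [measurable_cong]: "sets M = sets borel"
    and sets_N [measurable_cong]: "sets N = sets borel"
    and compact_S: "compact S" and S_ne: "S \<noteq> {}"
    and compact_K: "compact K" and K_ne: "K \<noteq> {}"
    and AE_S: "AE x in M. x \<in> S" and AE_K: "AE y in N. y \<in> K"
begin

text \<open>Discontinuous potentials have to compete as well, because the variation used below subtracts
  a multiple of the indicator of a closed set.\<close>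

definition competitor :: "('a \<Rightarrow> real) \<Rightarrow> bool" where
  "competitor \<phi> \<longleftrightarrow> bounded (\<phi> ` K) \<and> (\<lambda>y. indicator K y * \<phi> y) \<in> borel_measurable borel"

definition cost :: "('a \<Rightarrow> real) \<Rightarrow> real" where
  "cost \<phi> = (\<integral>y. indicator K y * \<phi> y \<partial>N) + (\<integral>x. legendre K \<phi> x \<partial>M)"

lemma bounded_K: "bounded K" and bounded_S: "bounded S"
  using compact_K compact_S by (auto intro: compact_imp_bounded)

lemma competitor_continuous:
  assumes "continuous_on K \<phi>" shows "competitor \<phi>"
proof -
  have "(\<lambda>y. indicator K y *\<^sub>R \<phi> y) \<in> borel_measurable borel"
    using assms compact_K by (intro borel_measurable_continuous_on_indicator) (auto intro: borel_compact)
  then show ?thesis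
    using assms compact_K unfolding competitor_def
    by (auto intro!: compact_imp_bounded compact_continuous_image)
qed

lemma integrable_potential:
  assumes "competitor \<phi>" shows "integrable N (\<lambda>y. indicator K y * \<phi> y)"
proof -
  obtain b where b: "\<And>y. y \<in> K \<Longrightarrow> \<bar>\<phi> y\<bar> \<le> b"
    using assms by (auto simp: bounded_iff competitor_def)
  have "\<bar>indicator K y * \<phi> y\<bar> \<le> \<bar>b\<bar>" for y
    using b[of y] by (auto simp: indicator_def)
  then show ?thesis
    using assms unfolding competitor_def
    by (intro N.integrable_const_bound[of _ "\<bar>b\<bar>"]) (auto simp: measurable_cong_sets[OF sets_N refl])
qed

lemma integrable_continuous_M:
  assumes "continuous_on UNIV (h :: 'a \<Rightarrow> real)" shows "integrable M h"
proof -
  have "bounded (h ` S)"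
    using assms compact_S by (intro compact_imp_bounded compact_continuous_image) (auto intro: continuous_on_subset)
  then obtain b where b: "\<And>x. x \<in> S \<Longrightarrow> \<bar>h x\<bar> \<le> b" by (auto simp: bounded_iff)
  have "AE x in M. norm (h x) \<le> b" using AE_S b by (auto elim: eventually_mono)
  then show ?thesis
    using assms by (intro M.integrable_const_bound[of _ b])
      (auto simp: measurable_cong_sets[OF sets_M refl] intro: borel_measurable_continuous_onI)
qed

lemma integrable_legendre:
  assumes "competitor \<phi>" shows "integrable M (legendre K \<phi>)"
  using assms continuous_on_legendre[OF K_ne bounded_K] unfolding competitor_def
  by (intro integrable_continuous_M) auto

text \<open>Shifting a potential by a constant shifts its transform by the opposite constant. Since both
  measures have mass one, the two error terms then cancel; this is why \<open>a\<close> and \<open>b\<close> are allowed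
  to be negative.\<close>

lemma cost_mono:
  assumes "competitor \<phi>" "competitor \<psi>"
    and le: "\<And>y. y \<in> K \<Longrightarrow> \<phi> y \<le> \<psi> y + a"
    and le': "\<And>x. x \<in> S \<Longrightarrow> legendre K \<phi> x \<le> legendre K \<psi> x + b"
  shows "cost \<phi> \<le> cost \<psi> + a + b"
proof -
  have "(\<integral>y. indicator K y * \<phi> y \<partial>N) \<le> (\<integral>y. indicator K y * \<psi> y + a \<partial>N)"
    using AE_K le
    by (intro integral_mono_AE integrable_potential Bochner_Integration.integrable_add assms)
      (auto elim!: eventually_mono)
  also have "\<dots> = (\<integral>y. indicator K y * \<psi> y \<partial>N) + a"
    using integrable_potential[OF assms(2)] by (simp add: N.prob_space)
  finally have 1: "(\<integral>y. indicator K y * \<phi> y \<partial>N) \<le> (\<integral>y. indicator K y * \<psi> y \<partial>N) + a" .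
  have "(\<integral>x. legendre K \<phi> x \<partial>M) \<le> (\<integral>x. legendre K \<psi> x + b \<partial>M)"
    using AE_S le'
    by (intro integral_mono_AE integrable_legendre Bochner_Integration.integrable_add assms)
      (auto elim!: eventually_mono)
  also have "\<dots> = (\<integral>x. legendre K \<psi> x \<partial>M) + b"
    using integrable_legendre[OF assms(2)] by (simp add: M.prob_space)
  finally show ?thesis using 1 by (simp add: cost_def)
qed

text \<open>Transforming back and forth never increases the cost and turns an arbitrary bounded potential
  into one whose Lipschitz constant is controlled by the size of \<open>S\<close>. This is the source of
  compactness.\<close>

lemma double_legendre:
  assumes "bounded (\<psi> ` K)"
  defines "\<psi>' \<equiv> legendre S (legendre K \<psi>)"
  shows "y \<in> K \<Longrightarrow> \<psi>' y \<le> \<psi> y"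
    and "x \<in> S \<Longrightarrow> legendre K \<psi>' x \<le> legendre K \<psi> x"
    and "S \<subseteq> cball 0 R \<Longrightarrow> 0 \<le> R \<Longrightarrow> R-lipschitz_on K \<psi>'"
proof -
  have b: "bounded (legendre K \<psi> ` S)"
    using continuous_on_legendre[OF K_ne bounded_K assms(1)] compact_S
    by (intro compact_imp_bounded compact_continuous_image)
  show "\<psi>' y \<le> \<psi> y" if "y \<in> K"
    unfolding \<psi>'_def
  proof (rule legendre_least[OF S_ne])
    fix x assume "x \<in> S"
    show "y \<bullet> x - legendre K \<psi> x \<le> \<psi> y"
      using legendre_upper[OF bounded_K assms(1) that, of x] by (simp add: inner_commute)
  qed
  show "legendre K \<psi>' x \<le> legendre K \<psi> x" if "x \<in> S"
  proof (rule legendre_least[OF K_ne])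
    fix y
    show "x \<bullet> y - \<psi>' y \<le> legendre K \<psi> x"
      using legendre_upper[OF bounded_S b that, of y] by (simp add: inner_commute \<psi>'_def)
  qed
  show "R-lipschitz_on K \<psi>'" if "S \<subseteq> cball 0 R" "0 \<le> R"
    unfolding \<psi>'_def using legendre_Lipschitz[OF S_ne that(1) b that(2)] lipschitz_on_subset by blast
qed

text \<open>By double transformation and a shift, it suffices to compete among functions with a fixed
  Lipschitz constant that vanish at a fixed point of \<open>K\<close>. On this class the cost is bounded below
  and continuous for uniform convergence, and the class is relatively compact by Arzela-Ascoli. The
  limit is continuous on \<open>K\<close>, hence a competitor.\<close>

lemma cost_minimizer:
  obtains \<phi> where "continuous_on K \<phi>" "\<And>\<psi>. competitor \<psi> \<Longrightarrow> cost \<phi> \<le> cost \<psi>"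
proof -
  obtain R where R: "0 < R" "S \<subseteq> cball 0 R"
    using bounded_S bounded_pos by (metis mem_cball_0 subsetI)
  obtain R' where R': "0 < R'" "K \<subseteq> cball 0 R'"
    using bounded_K bounded_pos by (metis mem_cball_0 subsetI)
  obtain y0 where y0: "y0 \<in> K" using K_ne by blast
  define L where "L = {\<phi>. R-lipschitz_on K \<phi> \<and> \<phi> y0 = (0::real)}"
  have Lcont: "continuous_on K \<phi>" if "\<phi> \<in> L" for \<phi>
    using that lipschitz_on_continuous_on by (auto simp: L_def)
  have Ladm: "competitor \<phi>" if "\<phi> \<in> L" for \<phi>
    using that Lcont competitor_continuous by blast
  have Lbound: "\<bar>\<phi> y\<bar> \<le> R * (2 * R')" if "\<phi> \<in> L" "y \<in> K" for \<phi> y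
  proof -
    have "dist (\<phi> y) (\<phi> y0) \<le> R * dist y y0"
      using that y0 unfolding L_def lipschitz_on_def by blast
    moreover have "dist y y0 \<le> 2 * R'"
      using that y0 R'(2) by (smt (verit) dist_triangle2 mem_cball subsetD dist_commute)
    ultimately have "dist (\<phi> y) (\<phi> y0) \<le> R * (2 * R')"
      using R(1) by (meson less_imp_le mult_left_mono order_trans)
    then show ?thesis using that by (simp add: L_def dist_real_def)
  qed
  have zL: "(\<lambda>_. 0) \<in> L" using R by (auto simp: L_def lipschitz_on_def)
  have reduce: "\<exists>\<phi>\<in>L. cost \<phi> \<le> cost \<psi>" if "competitor \<psi>" for \<psi>
  proof -
    have b: "bounded (\<psi> ` K)" using that by (simp add: competitor_def)
    define \<psi>' where "\<psi>' = legendre S (legendre K \<psi>)"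
    define \<phi> where "\<phi> y = \<psi>' y - \<psi>' y0" for y
    have lip: "R-lipschitz_on K \<psi>'"
      unfolding \<psi>'_def using double_legendre(3)[OF b] R by simp
    then have "\<phi> \<in> L" by (auto simp: L_def \<phi>_def lipschitz_on_def dist_real_def)
    have adm': "competitor \<psi>'" using lip lipschitz_on_continuous_on competitor_continuous by blast
    have b': "bounded (\<psi>' ` K)" using adm' by (simp add: competitor_def)
    have sh: "legendre K \<phi> x \<le> legendre K \<psi>' x + \<psi>' y0" for x
    proof (rule legendre_least[OF K_ne])
      fix y assume "y \<in> K"
      from legendre_upper[OF bounded_K b' this, of x]
      show "x \<bullet> y - \<phi> y \<le> legendre K \<psi>' x + \<psi>' y0" by (simp add: \<phi>_def)
    qed
    have "cost \<phi> \<le> cost \<psi>' + (- \<psi>' y0) + \<psi>' y0"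
      by (rule cost_mono[OF Ladm[OF \<open>\<phi> \<in> L\<close>] adm' _ sh]) (simp add: \<phi>_def)
    also have "\<dots> \<le> cost \<psi>"
      using cost_mono[OF adm' that, of 0 0] double_legendre(1,2)[OF b] by (simp add: \<psi>'_def)
    finally show ?thesis using \<open>\<phi> \<in> L\<close> by blast
  qed
  have "bdd_below (cost ` L)"
  proof (rule bdd_belowI2)
    fix \<phi> assume \<phi>: "\<phi> \<in> L"
    have "cost (\<lambda>_. 0) \<le> cost \<phi> + R * (2 * R') + R * (2 * R')"
    proof (rule cost_mono[OF Ladm[OF zL] Ladm[OF \<phi>]])
      fix y assume "y \<in> K" then show "0 \<le> \<phi> y + R * (2 * R')" using Lbound[OF \<phi>, of y] by linarith
    next
      fix x show "legendre K (\<lambda>_. 0) x \<le> legendre K \<phi> x + R * (2 * R')"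
      proof (rule legendre_least[OF K_ne])
        fix y assume y: "y \<in> K"
        have "bounded (\<phi> ` K)" using Ladm[OF \<phi>] by (simp add: competitor_def)
        from legendre_upper[OF bounded_K this y, of x] Lbound[OF \<phi> y]
        show "x \<bullet> y - 0 \<le> legendre K \<phi> x + R * (2 * R')" by linarith
      qed
    qed
    then show "cost (\<lambda>_. 0) - R * (2 * R') - R * (2 * R') \<le> cost \<phi>" by linarith
  qed
  note bdd = this
  define I where "I = Inf (cost ` L)"
  have Ile: "I \<le> cost \<phi>" if "\<phi> \<in> L" for \<phi>
    unfolding I_def using bdd that by (rule cINF_lower)
  have "\<exists>\<phi>\<in>L. cost \<phi> < I + 1 / real (Suc n)" for n
  proof -
    have "Inf (cost ` L) < I + 1 / real (Suc n)" by (simp add: I_def)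
    then show ?thesis using cINF_less_iff[OF _ bdd] zL by blast
  qed
  then obtain F where F: "\<And>n. F n \<in> L" "\<And>n. cost (F n) < I + 1 / real (Suc n)" by metis
  have eq: "\<exists>d>0. \<forall>n y. y \<in> K \<and> norm (x - y) < d \<longrightarrow> norm (F n x - F n y) < e"
    if "x \<in> K" "0 < e" for x e
  proof (intro exI conjI allI impI)
    show "0 < e / R" using R that by simp
    fix n y assume y: "y \<in> K \<and> norm (x - y) < e / R"
    have "norm (F n x - F n y) \<le> R * norm (x - y)"
      using F(1)[of n] y that by (auto simp: L_def lipschitz_on_def dist_norm)
    also have "\<dots> < e" using y R by (simp add: field_simps)
    finally show "norm (F n x - F n y) < e" .
  qed
  have nb: "norm (F n x) \<le> R * (2 * R')" if "x \<in> K" for n x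
    using Lbound[OF F(1) that] by simp
  obtain g k where g: "continuous_on K g" "strict_mono (k :: nat \<Rightarrow> nat)"
    and conv: "\<And>e. 0 < e \<Longrightarrow> \<exists>N. \<forall>n x. n \<ge> N \<and> x \<in> K \<longrightarrow> norm (F (k n) x - g x) < e"
    by (rule Arzela_Ascoli[OF compact_K nb eq]; (assumption | (rule that, assumption+)))
  have gadm: "competitor g" using g competitor_continuous by blast
  have "cost g \<le> I"
  proof (rule field_le_epsilon)
    fix e :: real assume "0 < e"
    then obtain N where N: "\<And>n x. n \<ge> N \<Longrightarrow> x \<in> K \<Longrightarrow> norm (F (k n) x - g x) < e / 3"
      using conv[of "e/3"] by auto
    obtain n0 where n0: "1 / real (Suc n0) < e / 3"
      using \<open>0 < e\<close> reals_Archimedean[of "e/3"] by (auto simp: inverse_eq_divide)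
    define n where "n = max N n0"
    have "n0 \<le> k n" using seq_suble[OF g(2), of n] by (simp add: n_def)
    then have "1 / real (Suc (k n)) \<le> 1 / real (Suc n0)" by (simp add: field_simps)
    then have small: "cost (F (k n)) < I + e / 3" using F(2)[of "k n"] n0 by linarith
    have close: "\<bar>F (k n) y - g y\<bar> < e / 3" if "y \<in> K" for y
      using N[of n y] that by (simp add: n_def)
    have "cost g \<le> cost (F (k n)) + e / 3 + e / 3"
    proof (rule cost_mono[OF gadm Ladm[OF F(1)]])
      fix y assume "y \<in> K" then show "g y \<le> F (k n) y + e / 3" using close[of y] by linarith
    next
      fix x show "legendre K g x \<le> legendre K (F (k n)) x + e / 3"
      proof (rule legendre_least[OF K_ne])
        fix y assume y: "y \<in> K"
        have "bounded (F (k n) ` K)" using Ladm[OF F(1)] by (simp add: competitor_def)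
        from legendre_upper[OF bounded_K this y, of x] close[OF y]
        show "x \<bullet> y - g y \<le> legendre K (F (k n)) x + e / 3" by linarith
      qed
    qed
    then show "cost g \<le> I + e" using small by linarith
  qed
  then show thesis using that[OF g(1)] reduce Ile by (meson order_trans)
qed

text \<open>The optimality condition. Lower the minimiser \<open>\<phi>\<close> by a small \<open>e > 0\<close> on a closed set \<open>C\<close>.
  The first term of the cost drops by \<open>e\<close> times the mass of \<open>C\<close>. The transform rises by at most
  \<open>e\<close>, and it rises only at points \<open>x\<close> where some element of \<open>C\<close> is within \<open>e\<close> of being a
  maximiser of \<open>x \<bullet> y - \<phi> y\<close>. Minimality compares the two masses, and \<open>e\<close> tending to zero leaves
  the exact maximisers.\<close>

lemma optimal_potential:
  obtains \<phi> where "continuous_on K \<phi>"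
    "\<And>C. closed C \<Longrightarrow> measure N C \<le> measure M {x\<in>S. \<exists>y\<in>C \<inter> K. legendre K \<phi> x = x \<bullet> y - \<phi> y}"
proof -
  obtain \<phi> where \<phi>: "continuous_on K \<phi>" and min: "\<And>\<psi>. competitor \<psi> \<Longrightarrow> cost \<phi> \<le> cost \<psi>"
    using cost_minimizer by blast
  have adm: "competitor \<phi>" using \<phi> by (rule competitor_continuous)
  then have b: "bounded (\<phi> ` K)" by (simp add: competitor_def)
  let ?u = "legendre K \<phi>"
  have "measure N C \<le> measure M {x\<in>S. \<exists>y\<in>C \<inter> K. ?u x = x \<bullet> y - \<phi> y}" if C: "closed C" for C
  proof (cases "C \<inter> K = {}")
    case True
    have "AE y in N. y \<notin> C" using AE_K True by (auto elim!: eventually_mono)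
    then have "measure N C = 0" using C
      by (subst N.prob_eq_0) (auto simp: sets_N)
    then show ?thesis by simp
  next
    case False
    have cCK: "compact (C \<inter> K)" using C compact_K by (simp add: closed_Int_compact)
    have \<phi>C: "continuous_on (C \<inter> K) \<phi>" by (rule continuous_on_subset[OF \<phi>]) auto
    have bC: "bounded (\<phi> ` (C \<inter> K))" by (rule bounded_subset[OF b]) auto
    define s where "s = legendre (C \<inter> K) \<phi>"
    have cont_s: "continuous_on UNIV s"
      unfolding s_def by (rule continuous_on_legendre[OF False compact_imp_bounded[OF cCK] bC])
    have cont_u: "continuous_on UNIV ?u"
      by (rule continuous_on_legendre[OF K_ne bounded_K b])
    \<comment> \<open>The points at which some element of \<open>C\<close> is a maximiser up to \<open>e\<close>.\<close>
    define A where "A e = {x. ?u x \<le> s x + e}" for e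
    have A_closed: "closed (A e)" for e
      unfolding A_def by (intro closed_Collect_le continuous_intros cont_s cont_u)
    then have A_sets: "A e \<in> sets M" for e by (simp add: sets_M)
    have eps: "measure N C \<le> measure M (A e)" if "0 < e" for e
    proof -
      define \<psi> where "\<psi> y = \<phi> y - e * indicator C y" for y
      obtain b0 where b0: "\<And>y. y \<in> K \<Longrightarrow> \<bar>\<phi> y\<bar> \<le> b0" using b by (auto simp: bounded_iff)
      have "\<bar>\<psi> y\<bar> \<le> b0 + e" if "y \<in> K" for y
        using b0[OF that] \<open>0 < e\<close> by (auto simp: \<psi>_def indicator_def)
      then have b\<psi>: "bounded (\<psi> ` K)" by (auto simp: bounded_iff)
      have meas: "(\<lambda>y. indicator K y * \<phi> y) \<in> borel_measurable borel"
        using adm by (simp add: competitor_def)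
      have eq: "indicator K y * \<psi> y = indicator K y * \<phi> y - e * indicator (C \<inter> K) y" for y
        by (auto simp: \<psi>_def indicator_def)
      have CK: "C \<inter> K \<in> sets borel" using cCK by (rule borel_compact)
      have adm\<psi>: "competitor \<psi>"
        unfolding competitor_def eq using b\<psi> meas CK by auto
      have ile: "legendre K \<psi> x \<le> ?u x + e * indicator (A e) x" for x
      proof (rule legendre_least[OF K_ne])
        fix y assume y: "y \<in> K"
        show "x \<bullet> y - \<psi> y \<le> ?u x + e * indicator (A e) x"
        proof (cases "y \<in> C")
          case True
          have 1: "x \<bullet> y - \<phi> y \<le> s x"
            unfolding s_def using True y bC bounded_K by (intro legendre_upper) (auto simp: bounded_Int)
          have 2: "x \<bullet> y - \<phi> y \<le> ?u x" using legendre_upper[OF bounded_K b y] .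
          show ?thesis using 1 2 True by (auto simp: \<psi>_def A_def indicator_def)
        next
          case False
          then show ?thesis using legendre_upper[OF bounded_K b y, of x] \<open>0 < e\<close>
            by (auto simp: \<psi>_def indicator_def)
        qed
      qed
      have "cost \<psi> \<le> (\<integral>y. indicator K y * \<phi> y \<partial>N) - e * measure N (C \<inter> K)
          + ((\<integral>x. ?u x \<partial>M) + e * measure M (A e))"
      proof -
        have "(\<integral>y. indicator K y * \<psi> y \<partial>N) = (\<integral>y. indicator K y * \<phi> y \<partial>N) - e * measure N (C \<inter> K)"
          unfolding eq using integrable_potential[OF adm] CK
          by (subst Bochner_Integration.integral_diff) (auto simp: sets_N N.emeasure_finite less_top[symmetric])
        moreover have "(\<integral>x. legendre K \<psi> x \<partial>M) \<le> (\<integral>x. ?u x + e * indicator (A e) x \<partial>M)"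
          using integrable_legendre[OF adm] integrable_legendre[OF adm\<psi>] A_sets ile
          by (intro integral_mono) (auto simp: M.emeasure_finite less_top[symmetric])
        moreover have "\<dots> = (\<integral>x. ?u x \<partial>M) + e * measure M (A e)"
          using integrable_legendre[OF adm] A_sets
          by (subst Bochner_Integration.integral_add) (auto simp: M.emeasure_finite less_top[symmetric])
        ultimately show ?thesis unfolding cost_def by linarith
      qed
      with min[OF adm\<psi>] have "e * measure N (C \<inter> K) \<le> e * measure M (A e)"
        unfolding cost_def by linarith
      moreover have "measure N C = measure N (C \<inter> K)"
        using AE_K C CK by (intro N.finite_measure_eq_AE) (auto simp: sets_N elim!: eventually_mono)
      ultimately show ?thesis using that by simp
    qed
    have "(\<lambda>n. measure M (A (1 / real (Suc n)))) \<longlonglongrightarrow> measure M (\<Inter>n. A (1 / real (Suc n)))"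
    proof (rule M.finite_Lim_measure_decseq)
      show "range (\<lambda>n. A (1 / real (Suc n))) \<subseteq> sets M" using A_sets by auto
      show "antimono (\<lambda>n. A (1 / real (Suc n)))"
      proof (rule antimonoI)
        fix m n :: nat assume "m \<le> n"
        then have "1 / real (Suc n) \<le> 1 / real (Suc m)" by (simp add: field_simps)
        then show "A (1 / real (Suc n)) \<subseteq> A (1 / real (Suc m))" by (auto simp: A_def)
      qed
    qed
    then have "measure N C \<le> measure M (\<Inter>n. A (1 / real (Suc n)))"
      by (rule LIMSEQ_le_const) (use eps in auto)
    also have "\<dots> \<le> measure M (A 0)"
    proof (rule M.finite_measure_mono[OF _ A_sets], rule subsetI)
      fix x assume x: "x \<in> (\<Inter>n. A (1 / real (Suc n)))"
      have "?u x \<le> s x"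
      proof (rule field_le_epsilon)
        fix e :: real assume "0 < e"
        then obtain n where "1 / real (Suc n) < e"
          using reals_Archimedean[of e] by (auto simp: inverse_eq_divide)
        moreover have "?u x \<le> s x + 1 / real (Suc n)" using x by (auto simp: A_def)
        ultimately show "?u x \<le> s x + e" by linarith
      qed
      then show "x \<in> A 0" by (simp add: A_def)
    qed
    also have "\<dots> = measure M (A 0 \<inter> S)"
      using AE_S A_sets borel_compact[OF compact_S]
      by (intro M.finite_measure_eq_AE) (auto simp: sets_M elim!: eventually_mono)
    also have "A 0 \<inter> S = {x\<in>S. \<exists>y\<in>C \<inter> K. ?u x = x \<bullet> y - \<phi> y}"
    proof -
      have "?u x \<le> s x \<longleftrightarrow> (\<exists>y\<in>C \<inter> K. ?u x = x \<bullet> y - \<phi> y)" for x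
      proof
        assume "?u x \<le> s x"
        moreover obtain y where "y \<in> C \<inter> K" "s x = x \<bullet> y - \<phi> y"
          unfolding s_def using legendre_attained[OF cCK False \<phi>C] by blast
        moreover have "x \<bullet> y - \<phi> y \<le> ?u x"
          using \<open>y \<in> C \<inter> K\<close> legendre_upper[OF bounded_K b] by blast
        ultimately show "\<exists>y\<in>C \<inter> K. ?u x = x \<bullet> y - \<phi> y" by force
      next
        assume "\<exists>y\<in>C \<inter> K. ?u x = x \<bullet> y - \<phi> y"
        then obtain y where "y \<in> C \<inter> K" "?u x = x \<bullet> y - \<phi> y" by blast
        moreover have "x \<bullet> y - \<phi> y \<le> s x"
          unfolding s_def using \<open>y \<in> C \<inter> K\<close> bC bounded_K by (intro legendre_upper) (auto simp: bounded_Int)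
        ultimately show "?u x \<le> s x" by simp
      qed
      then show ?thesis by (auto simp: A_def)
    qed
    finally show ?thesis .
  qed
  then show thesis using that \<phi> by blast
qed

end

section \<open>Subgradients and differentiability\<close>

abbreviation subgrad :: "('a::real_inner \<Rightarrow> real) \<Rightarrow> 'a \<Rightarrow> 'a set" where
  "subgrad u \<equiv> subdifferential (\<lambda>x. ereal (u x))"

lemma mem_subgrad_iff: "p \<in> subgrad u x \<longleftrightarrow> (\<forall>y. u x + p \<bullet> (y - x) \<le> u y)"
  by (simp add: subdifferential_def)

lemma maximizer_in_subgrad_legendre:
  assumes "bounded K" "bounded (\<phi> ` K)" "p \<in> K" "legendre K \<phi> x = x \<bullet> p - \<phi> p"
  shows "p \<in> subgrad (legendre K \<phi>) x"
  unfolding mem_subgrad_iff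
  using legendre_upper[OF assms(1-3)] assms(4) by (simp add: inner_diff_right inner_commute)

text \<open>A slope outside \<open>K\<close> is strictly separated from \<open>K\<close> by some direction \<open>a\<close>; in the direction
  \<open>- a\<close> the transform decreases at least as fast as the slopes in \<open>K\<close> allow, which contradicts the
  subgradient inequality.\<close>

lemma subgrad_legendre_subset:
  fixes K :: "'a::euclidean_space set"
  assumes "compact K" "convex K" "K \<noteq> {}" "bounded (\<phi> ` K)"
  shows "subgrad (legendre K \<phi>) x \<subseteq> K"
proof
  fix p assume p: "p \<in> subgrad (legendre K \<phi>) x"
  show "p \<in> K"
  proof (rule ccontr)
    assume "p \<notin> K"
    then obtain a b where ab: "a \<bullet> p < b" "\<And>y. y \<in> K \<Longrightarrow> b < a \<bullet> y"
      using separating_hyperplane_closed_point[of K p] assms by (auto intro: compact_imp_closed)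
    have "legendre K \<phi> (x - a) \<le> legendre K \<phi> x - b"
    proof (rule legendre_least[OF assms(3)])
      fix y assume y: "y \<in> K"
      from legendre_upper[OF compact_imp_bounded[OF assms(1)] assms(4) y, of x] ab(2)[OF y]
      show "(x - a) \<bullet> y - \<phi> y \<le> legendre K \<phi> x - b" by (simp add: inner_diff_left)
    qed
    moreover have "legendre K \<phi> x + p \<bullet> ((x - a) - x) \<le> legendre K \<phi> (x - a)"
      using p unfolding mem_subgrad_iff by blast
    ultimately show False using ab(1) by (simp add: inner_commute)
  qed
qed

lemma closed_subgrad_graph:
  fixes u :: "'a::euclidean_space \<Rightarrow> real"
  assumes "continuous_on UNIV u"
  shows "closed {(x, p). p \<in> subgrad u x}"
proof -
  have "continuous_on UNIV (\<lambda>z::'a \<times> 'a. u (fst z))"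
    by (intro continuous_on_compose2[OF assms] continuous_intros) auto
  then have "closed {z::'a \<times> 'a. \<forall>y. u (fst z) + snd z \<bullet> (y - fst z) \<le> u y}"
    by (intro closed_Collect_all closed_Collect_le continuous_intros)
  moreover have "{(x, p). p \<in> subgrad u x} = {z. \<forall>y. u (fst z) + snd z \<bullet> (y - fst z) \<le> u y}"
    by (auto simp: mem_subgrad_iff)
  ultimately show ?thesis by simp
qed

text \<open>The graph of \<open>p\<close> is closed and its values lie in a compact set, so \<open>p\<close> is continuous. Differentiability follows by using the subgradient inequality at both end points: the
  error of the linear approximation lies between \<open>0\<close> and \<open>(p y - p x) \<bullet> (y - x)\<close>.\<close>

lemma unique_subgrad_imp_C1:
  fixes u :: "'a::euclidean_space \<Rightarrow> real"
  assumes "continuous_on UNIV u" "compact K"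
    and p: "\<And>x. subgrad u x = {p x}" "\<And>x. p x \<in> K"
  shows "has_gradient (\<lambda>x. ereal (u x)) x (p x)" and "continuous_on UNIV p"
proof -
  have "(\<lambda>x. (x, p x)) ` UNIV = {(x, q). q \<in> subgrad u x}" by (auto simp: p(1))
  then have "closed ((\<lambda>x. (x, p x)) ` UNIV)" using closed_subgrad_graph[OF assms(1)] by simp
  then show cont: "continuous_on UNIV p"
    using continuous_from_closed_graph[OF assms(2), of p UNIV] p(2) by auto
  have pp: "p x \<in> subgrad u x" for x by (simp add: p(1))
  have "(u has_derivative (\<lambda>h. h \<bullet> p x)) (at x)"
  proof (rule has_derivativeI_sandwich[of 1])
    show "bounded_linear (\<lambda>h. h \<bullet> p x)" by (rule bounded_linear_inner_left)
    show "((\<lambda>y. norm (p y - p x)) \<longlongrightarrow> 0) (at x)"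
    proof -
      have "(p \<longlongrightarrow> p x) (at x)" using cont by (simp add: continuous_on_def)
      then show ?thesis by (simp add: LIM_zero_iff tendsto_norm_zero_iff)
    qed
    fix y assume "y \<noteq> x"
    have 1: "u x + p x \<bullet> (y - x) \<le> u y" and 2: "u y + p y \<bullet> (x - y) \<le> u x"
      using pp unfolding mem_subgrad_iff by blast+
    have "norm (u y - u x - (y - x) \<bullet> p x) \<le> (p y - p x) \<bullet> (y - x)"
      using 1 2 by (simp add: inner_diff_left inner_diff_right inner_commute)
    also have "\<dots> \<le> norm (p y - p x) * norm (y - x)" by (rule norm_cauchy_schwarz)
    finally show "norm (u y - u x - (y - x) \<bullet> p x) / norm (y - x) \<le> norm (p y - p x)"
      using \<open>y \<noteq> x\<close> by (simp add: field_simps)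
  qed simp
  then show "has_gradient (\<lambda>x. ereal (u x)) x (p x)"
    by (simp add: has_gradient_def gderiv_def)
qed

lemma gradient_eqI:
  assumes "has_gradient u x p" shows "gradient u x = p"
  unfolding gradient_def
proof (rule the_equality, rule assms)
  fix q assume "has_gradient u x q"
  with assms have "(\<lambda>h. h \<bullet> q) = (\<lambda>h. h \<bullet> p)"
    unfolding has_gradient_def gderiv_def using has_derivative_unique by blast
  then show "q = p" by (metis inner_commute vector_eq_rdot)
qed

text \<open>Convexity bounds the difference quotients along the segment from \<open>x\<close> to \<open>y\<close> by
  \<open>v y - v x\<close>, and they converge to \<open>p \<bullet> (y - x)\<close>.\<close>

lemma has_gradient_imp_subdifferential:
  assumes "convex_ereal v" "has_gradient v x p"
  shows "p \<in> subdifferential v x"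
proof -
  have fin: "\<forall>\<^sub>F y in nhds x. \<bar>v y\<bar> \<noteq> \<infinity>"
    and der: "((\<lambda>y. real_of_ereal (v y)) has_derivative (\<lambda>h. h \<bullet> p)) (at x)"
    using assms(2) by (auto simp: has_gradient_def gderiv_def)
  have finx: "\<bar>v x\<bar> \<noteq> \<infinity>" using fin by (rule eventually_nhds_x_imp_x)
  have ninf: "v y \<noteq> -\<infinity>" for y using assms(1) by (simp add: convex_ereal_def)
  have "v x + ereal (p \<bullet> (y - x)) \<le> v y" for y
  proof (cases "v y = \<infinity>")
    case False
    then obtain b where b: "v y = ereal b" using ninf[of y] by (cases "v y") auto
    obtain a where a: "v x = ereal a" using finx by auto
    define r where "r t = real_of_ereal (v (x + t *\<^sub>R (y - x)))" for t
    have "((\<lambda>t. x + t *\<^sub>R (y - x)) has_derivative (\<lambda>t. t *\<^sub>R (y - x))) (at (0::real))"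
      by (auto intro!: derivative_eq_intros)
    then have "(r has_derivative (\<lambda>t. (t *\<^sub>R (y - x)) \<bullet> p)) (at 0)"
      unfolding r_def using der
      by (intro has_derivative_compose[where f = "\<lambda>t. x + t *\<^sub>R (y - x)"
            and g = "\<lambda>y. real_of_ereal (v y)"]) auto
    moreover have "(\<lambda>t. (t *\<^sub>R (y - x)) \<bullet> p) = (*) ((y - x) \<bullet> p)" by (auto simp: mult.commute)
    ultimately have "(r has_real_derivative (y - x) \<bullet> p) (at 0)"
      by (simp add: has_field_derivative_def)
    then have lim: "((\<lambda>t. (r t - r 0) / t) \<longlongrightarrow> (y - x) \<bullet> p) (at_right 0)"
      unfolding has_field_derivative_iff
      using filterlim_at_split by fastforce
    have ev: "\<forall>\<^sub>F t in at_right 0. (r t - r 0) / t \<le> b - a"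
    proof -
      have "((\<lambda>t. x + t *\<^sub>R (y - x)) \<longlongrightarrow> x + 0 *\<^sub>R (y - x)) (at_right (0::real))"
        by (intro tendsto_intros)
      then have "\<forall>\<^sub>F t in at_right (0::real). \<bar>v (x + t *\<^sub>R (y - x))\<bar> \<noteq> \<infinity>"
        using fin by (auto simp: filterlim_iff elim!: allE[of _ "\<lambda>y. \<bar>v y\<bar> \<noteq> \<infinity>"])
      moreover have "\<forall>\<^sub>F t in at_right (0::real). t \<in> {0<..<1}"
        by (rule eventually_at_right_real) simp
      ultimately show ?thesis
      proof eventually_elim
        case (elim t)
        then have t: "0 < t" "t < 1" by auto
        have "v ((1 - t) *\<^sub>R x + t *\<^sub>R y) \<le> ereal (1 - t) * v x + ereal t * v y"
          using assms(1) t unfolding convex_ereal_def by (meson diff_ge_0_iff_ge less_imp_le diff_add_cancel)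
        moreover have "(1 - t) *\<^sub>R x + t *\<^sub>R y = x + t *\<^sub>R (y - x)" by (simp add: algebra_simps)
        ultimately have "ereal (r t) \<le> ereal ((1 - t) * a + t * b)"
          using elim(1) a b by (simp add: r_def ereal_real)
        moreover have "r 0 = a" by (simp add: r_def a)
        ultimately have "r t - r 0 \<le> (b - a) * t" by (simp add: algebra_simps)
        then show ?case using t by (simp add: divide_le_eq)
      qed
    qed
    have "(y - x) \<bullet> p \<le> b - a"
      by (rule tendsto_upperbound[OF lim ev]) simp
    then show ?thesis by (simp add: a b inner_commute)
  qed simp
  then show ?thesis using finx by (simp add: subdifferential_def)
qed

lemma continuous_of_bounded_subgrads:
  fixes v :: "'a::real_inner \<Rightarrow> real"
  assumes "0 \<le> R" "\<And>x. \<exists>p\<in>subgrad v x. norm p \<le> R"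
  shows "continuous_on UNIV v"
proof -
  have le: "v x - v y \<le> R * dist x y" for x y
  proof -
    obtain p where p: "p \<in> subgrad v x" "norm p \<le> R" using assms(2) by blast
    have "v x + p \<bullet> (y - x) \<le> v y" using p(1) unfolding mem_subgrad_iff by blast
    moreover have "- (p \<bullet> (y - x)) \<le> norm p * norm (y - x)"
      using norm_cauchy_schwarz[of "- p" "y - x"] by simp
    moreover have "norm p * norm (y - x) \<le> R * norm (y - x)" using p(2) by (intro mult_right_mono) auto
    ultimately show ?thesis by (simp add: dist_norm norm_minus_commute)
  qed
  have "R-lipschitz_on UNIV v"
    unfolding lipschitz_on_def dist_real_def
  proof (intro conjI ballI)
    fix x y show "\<bar>v x - v y\<bar> \<le> R * dist x y"
      using le[of x y] le[of y x] by (simp add: dist_commute abs_le_iff)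
  qed (fact assms)
  then show ?thesis by (rule lipschitz_on_continuous_on)
qed

lemma convex_ereal_of_subgrads:
  fixes u :: "'a::real_inner \<Rightarrow> real"
  assumes "\<And>x. subgrad u x \<noteq> {}"
  shows "convex_ereal (\<lambda>x. ereal (u x))"
  unfolding convex_ereal_def
proof (intro conjI allI impI)
  fix x y :: 'a and s t :: real assume st: "0 \<le> s" "0 \<le> t" "s + t = 1"
  define z where "z = s *\<^sub>R x + t *\<^sub>R y"
  obtain p where "p \<in> subgrad u z" using assms by blast
  then have "u z + p \<bullet> (x - z) \<le> u x" "u z + p \<bullet> (y - z) \<le> u y" unfolding mem_subgrad_iff by blast+
  then have "s * (u z + p \<bullet> (x - z)) + t * (u z + p \<bullet> (y - z)) \<le> s * u x + t * u y"
    using st by (intro add_mono mult_left_mono) auto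
  moreover have "s * (u z + p \<bullet> (x - z)) + t * (u z + p \<bullet> (y - z))
      = (s + t) * u z + p \<bullet> (s *\<^sub>R x + t *\<^sub>R y - (s + t) *\<^sub>R z)"
    by (simp add: inner_diff_right inner_add_right algebra_simps)
  ultimately have "u z \<le> s * u x + t * u y" using st(3) by (simp flip: z_def)
  then show "ereal (u (s *\<^sub>R x + t *\<^sub>R y)) \<le> ereal s * ereal (u x) + ereal t * ereal (u y)"
    by (simp add: z_def)
qed simp

lemma lsc_of_continuous:
  fixes u :: "'a::perfect_space \<Rightarrow> real"
  assumes "continuous_on UNIV u" shows "lsc (\<lambda>x. ereal (u x))"
  unfolding lsc_def
proof
  fix x
  have "(u \<longlongrightarrow> u x) (at x)" using assms by (simp add: continuous_on_def)
  then have "((\<lambda>x. ereal (u x)) \<longlongrightarrow> ereal (u x)) (at x)" by simp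
  then have "Liminf (at x) (\<lambda>x. ereal (u x)) = ereal (u x)" by (intro lim_imp_Liminf) simp_all
  then show "ereal (u x) \<le> Liminf (at x) (\<lambda>x. ereal (u x))" by simp
qed

section \<open>Uniqueness of slopes in the plane\<close>

definition quarter_turn :: "real^2 \<Rightarrow> real^2" where
  "quarter_turn e = vector [- (e$2), e$1]"

text \<open>A rectangle in the frame \<open>e\<close>, \<open>quarter_turn e\<close>. The frame is orthogonal but not normalised,
  hence the factor \<open>e \<bullet> e\<close> in its area.\<close>

definition rot_box :: "real^2 \<Rightarrow> real \<Rightarrow> real \<Rightarrow> real \<Rightarrow> real \<Rightarrow> (real^2) set" where
  "rot_box e a b c d = {x. a \<le> x \<bullet> e \<and> x \<bullet> e \<le> b \<and> c \<le> x \<bullet> quarter_turn e \<and> x \<bullet> quarter_turn e \<le> d}"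

lemma inner_real2: "x \<bullet> y = x$1 * y$1 + x$2 * y$2" for x y :: "real^2"
  by (simp add: inner_vec_def sum_2)

lemma inner_decompose:
  fixes e x y :: "real^2"
  shows "(e \<bullet> e) * (x \<bullet> y) = (x \<bullet> e) * (y \<bullet> e) + (x \<bullet> quarter_turn e) * (y \<bullet> quarter_turn e)"
  by (simp add: inner_real2 quarter_turn_def algebra_simps)

lemma measure_rot_box:
  assumes "e \<noteq> 0" "a \<le> b" "c \<le> d"
  shows "compact (rot_box e a b c d)"
    and "measure lebesgue (rot_box e a b c d) = (b - a) * (d - c) / (e \<bullet> e)"
proof -
  define L where "L z = (1 / (e \<bullet> e)) *\<^sub>R (z$1 *\<^sub>R e + z$2 *\<^sub>R quarter_turn e)" for z :: "real^2"
  have ee: "e \<bullet> e > 0" using assms by simp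
  have lin: "linear L"
    by (rule linearI) (simp_all add: L_def algebra_simps)
  define B where "B = cbox (vector [a, c]) (vector [b, d] :: real^2)"
  have nn: "quarter_turn e \<bullet> quarter_turn e = e \<bullet> e" "quarter_turn e \<bullet> e = 0" "e \<bullet> quarter_turn e = 0"
    by (simp_all add: inner_real2 quarter_turn_def)
  have Le: "L z \<bullet> e = z$1" "L z \<bullet> quarter_turn e = z$2" for z
    using ee by (simp_all add: L_def inner_add_left nn)
  have img: "rot_box e a b c d = L ` B"
  proof (intro equalityI subsetI)
    fix x assume x: "x \<in> rot_box e a b c d"
    let ?z = "vector [x \<bullet> e, x \<bullet> quarter_turn e] :: real^2"
    have "x \<bullet> y = L ?z \<bullet> y" for y
    proof -
      have "L ?z \<bullet> y = ((x \<bullet> e) * (y \<bullet> e) + (x \<bullet> quarter_turn e) * (y \<bullet> quarter_turn e)) / (e \<bullet> e)"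
        by (simp add: L_def inner_add_left inner_commute[of y] add_divide_distrib)
      then show ?thesis using ee by (simp flip: inner_decompose)
    qed
    then have "x = L ?z" by (metis vector_eq_rdot)
    moreover have "?z \<in> B" using x by (simp add: B_def rot_box_def mem_box_cart forall_2)
    ultimately show "x \<in> L ` B" by blast
  next
    fix x assume "x \<in> L ` B"
    then obtain z where "x = L z" "z \<in> B" by blast
    then show "x \<in> rot_box e a b c d"
      by (simp add: rot_box_def B_def mem_box_cart forall_2 Le)
  qed
  show "compact (rot_box e a b c d)"
    unfolding img B_def
    by (intro compact_continuous_image linear_continuous_on) (simp_all add: lin linear_conv_bounded_linear[symmetric])
  have "det (matrix L) = 1 / (e \<bullet> e)"
  proof -
    have "det (matrix L) = (1 / (e \<bullet> e)) * (1 / (e \<bullet> e)) * (e \<bullet> e)"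
      by (simp add: det_2 matrix_def L_def quarter_turn_def axis_def inner_real2 add_divide_distrib
          algebra_simps)
    then show ?thesis using ee by simp
  qed
  moreover have "measure lebesgue B = (b - a) * (d - c)"
  proof -
    have "B \<noteq> {}" using assms by (auto simp: B_def interval_ne_empty_cart forall_2)
    then show ?thesis unfolding B_def by (simp add: content_cbox_cart UNIV_2)
  qed
  ultimately show "measure lebesgue (rot_box e a b c d) = (b - a) * (d - c) / (e \<bullet> e)"
    unfolding img using measure_linear_image[OF lin, of B] ee by (simp add: B_def)
qed


lemma frame_eqI:
  assumes "e \<noteq> 0" "x \<bullet> e = y \<bullet> e" "x \<bullet> quarter_turn e = y \<bullet> quarter_turn e"
  shows "x = y"
proof -
  have "(e \<bullet> e) * (x \<bullet> z) = (e \<bullet> e) * (y \<bullet> z)" for z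
    unfolding inner_decompose using assms by simp
  then show ?thesis using assms(1) by (metis inner_eq_zero_iff mult_cancel_left vector_eq_rdot)
qed

text \<open>The heart of the regularity statement. Suppose that \<open>u\<close> has two slopes at \<open>x0\<close>, with
  difference \<open>e\<close> and midpoint \<open>m\<close>, and let \<open>D\<close> be \<open>u\<close> minus the affine function of slope \<open>m\<close>.
  Then \<open>D\<close> grows at least like half of \<open>\<bar>(x - x0) \<bullet> e\<bar>\<close> away from the line through \<open>x0\<close>
  orthogonal to \<open>e\<close>. The target \<open>Y\<close> has points on at least one side of the segment of slopes;
  the normal \<open>n\<close> points to that side. Follow the zero set of \<open>D\<close> from \<open>x0\<close> in the direction \<open>n\<close>.
  It is bounded, since otherwise no slope would lie strictly on the side of \<open>n\<close>, so it has a last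
  point \<open>x1\<close>.

  By convexity \<open>Y\<close> contains the rectangle \<open>C\<close> of slopes at distance between \<open>d/2\<close> and \<open>d\<close> from
  the middle half of the segment, up to normalisation. A point of \<open>S\<close> having such a slope lies in
  a cone of opening of order \<open>d\<close> with apex \<open>x1\<close>, and at height less than \<open>r\<close> over \<open>x1\<close> once
  \<open>d\<close> is small. So slopes filling an area proportional to \<open>d\<close> come from a set \<open>B\<close> of area
  proportional to \<open>d * r^2\<close>; as \<open>r\<close> may be chosen small, independently of \<open>d\<close>, this contradicts
  the area bound. Working on one side only is what allows the segment of slopes to lie in the
  boundary of \<open>Y\<close>.\<close>

lemma subgrad_unique_plane:
  fixes u :: "real^2 \<Rightarrow> real"
  assumes cont: "continuous_on UNIV u"
    and sub: "\<And>x. subgrad u x \<subseteq> closure Y"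
    and Y: "open Y" "convex Y" "Y \<noteq> {}"
    and S: "compact S"
    and area: "\<And>C B. \<lbrakk>compact C; C \<subseteq> Y; compact B;
        \<And>x p. \<lbrakk>x \<in> S; p \<in> C; p \<in> subgrad u x\<rbrakk> \<Longrightarrow> x \<in> B\<rbrakk>
        \<Longrightarrow> measure lebesgue C \<le> \<Lambda> * measure lebesgue B"
    and p: "p0 \<in> subgrad u x0" "p1 \<in> subgrad u x0"
  shows "p0 = p1"
proof (rule ccontr)
  assume "p0 \<noteq> p1"
  define m where "m = (1/2) *\<^sub>R (p0 + p1)"
  \<comment> \<open>Choose the sign of \<open>e\<close> so that its normal points to a side on which \<open>Y\<close> has a point \<open>q\<close>; an open set is not contained in a line.\<close>
  obtain e q where e: "e \<noteq> 0" and me: "m - (1/2) *\<^sub>R e \<in> subgrad u x0" "m + (1/2) *\<^sub>R e \<in> subgrad u x0"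
    and q: "q \<in> Y" "0 < (q - m) \<bullet> quarter_turn e"
  proof -
    let ?e = "p1 - p0" and ?n = "quarter_turn (p1 - p0)"
    have nn: "?n \<bullet> ?n > 0"
      using \<open>p0 \<noteq> p1\<close> inner_decompose[of ?e ?e ?e]
      by (simp add: quarter_turn_def vec_eq_iff forall_2) (auto)
    obtain q' where q': "q' \<in> Y" using Y by blast
    have "\<exists>q\<in>Y. (q - m) \<bullet> ?n \<noteq> 0"
    proof (cases "(q' - m) \<bullet> ?n = 0")
      case True
      obtain r where r: "0 < r" "ball q' r \<subseteq> Y" using Y q' open_contains_ball by blast
      define t where "t = r / (2 * norm ?n)"
      have "norm ?n > 0" using nn by simp
      then have t: "t > 0" "t * norm ?n < r" using r by (simp_all add: t_def)
      then have "q' + t *\<^sub>R ?n \<in> Y" using r by (auto intro!: subsetD[OF r(2)] simp: dist_norm)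
      moreover have "(q' + t *\<^sub>R ?n - m) \<bullet> ?n = t * (?n \<bullet> ?n)"
        using True by (simp add: inner_diff_left inner_add_left)
      ultimately show ?thesis using t nn by (metis less_irrefl mult_pos_pos)
    qed (use q' in blast)
    then obtain q where q: "q \<in> Y" "(q - m) \<bullet> ?n \<noteq> 0" by blast
    have e1: "m - (1/2) *\<^sub>R ?e = p0" "m + (1/2) *\<^sub>R ?e = p1"
      by (simp_all add: m_def vec_eq_iff forall_2 field_simps)
    have e2: "m - (1/2) *\<^sub>R (- ?e) = p1" "m + (1/2) *\<^sub>R (- ?e) = p0"
      by (simp_all add: m_def vec_eq_iff forall_2 field_simps)
    have tn: "quarter_turn (- ?e) = - ?n" by (simp add: quarter_turn_def vec_eq_iff forall_2)
    show thesis
    proof (cases "(q - m) \<bullet> ?n > 0")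
      case True
      show thesis by (rule that[of ?e q]) (use \<open>p0 \<noteq> p1\<close> p e1 q True in auto)
    next
      case False
      show thesis
      proof (rule that[of "- ?e" q])
        show "- ?e \<noteq> 0" using \<open>p0 \<noteq> p1\<close> by simp
        show "m - (1/2) *\<^sub>R (- ?e) \<in> subgrad u x0" "m + (1/2) *\<^sub>R (- ?e) \<in> subgrad u x0"
          unfolding e2 using p by auto
        show "q \<in> Y" by fact
        show "0 < (q - m) \<bullet> quarter_turn (- ?e)" unfolding tn using q(2) False by simp
      qed
    qed
  qed
  define n where "n = quarter_turn e"
  define E where "E = e \<bullet> e"
  have E: "0 < E" using e by (simp add: E_def)
  have nn: "n \<bullet> n = E" "n \<bullet> e = 0" "e \<bullet> n = 0"
    by (simp_all add: E_def n_def inner_real2 quarter_turn_def)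
  have dec: "E * (x \<bullet> y) = (x \<bullet> e) * (y \<bullet> e) + (x \<bullet> n) * (y \<bullet> n)" for x y
    unfolding E_def n_def by (rule inner_decompose)
  define D where "D x = u x - u x0 - m \<bullet> (x - x0)" for x
  have contD: "continuous_on A D" for A
    unfolding D_def by (intro continuous_intros continuous_on_subset[OF cont]) auto
  have D0: "D x0 = 0" by (simp add: D_def)
  have subD: "D x + (p - m) \<bullet> (y - x) \<le> D y" if "p \<in> subgrad u x" for p x y
  proof -
    have "u x + p \<bullet> (y - x) \<le> u y" using that unfolding mem_subgrad_iff by blast
    then show ?thesis by (simp add: D_def inner_diff_left inner_diff_right)
  qed
  have lower0: "\<bar>(x - x0) \<bullet> e\<bar> / 2 \<le> D x" for x
    using subD[OF me(1), of x] subD[OF me(2), of x] by (simp add: D0 inner_commute)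
  define H where "H = (q - m) \<bullet> n"
  have H: "0 < H" using q by (simp add: H_def n_def)
  define T where "T = {t. 0 \<le> t \<and> D (x0 + t *\<^sub>R n) = 0}"
  have T0: "0 \<in> T" by (simp add: T_def D0)
  have "closed T"
    unfolding T_def
    by (intro closed_Collect_conj closed_Collect_le closed_Collect_eq continuous_intros
        continuous_on_compose2[OF contD[of UNIV]]) auto
  have "bdd_above T"
  proof -
    have "open (Y \<inter> {z. (z - m) \<bullet> n > 0})"
      by (intro open_Int Y open_Collect_less continuous_intros)
    moreover have "q \<in> Y \<inter> {z. (z - m) \<bullet> n > 0}" using q by (simp add: n_def)
    ultimately obtain r where r: "0 < r" "cball q r \<subseteq> Y \<inter> {z. (z - m) \<bullet> n > 0}"
      using open_contains_cball by metis
    have "\<exists>x p. p \<in> cball q r \<and> p \<in> subgrad u x"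
    proof (rule ccontr)
      assume "\<nexists>x p. p \<in> cball q r \<and> p \<in> subgrad u x"
      then have "measure lebesgue (cball q r) \<le> \<Lambda> * measure lebesgue ({} :: (real^2) set)"
        using r by (intro area[of "cball q r" "{}"]) auto
      then show False using content_cball_pos[OF r(1), of q] by simp
    qed
    then obtain x p where xp: "p \<in> cball q r" "p \<in> subgrad u x" by blast
    then have pos: "(p - m) \<bullet> n > 0" using r by blast
    show ?thesis
    proof (rule bdd_aboveI)
      fix t assume "t \<in> T"
      then have "D x + (p - m) \<bullet> (x0 + t *\<^sub>R n - x) \<le> 0"
        using subD[OF xp(2), of "x0 + t *\<^sub>R n"] by (simp add: T_def)
      then have "t * ((p - m) \<bullet> n) \<le> (p - m) \<bullet> (x - x0) - D x"
        by (simp add: inner_diff_right inner_add_right)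
      then show "t \<le> ((p - m) \<bullet> (x - x0) - D x) / ((p - m) \<bullet> n)"
        using pos by (simp add: pos_le_divide_eq)
    qed
  qed
  define l where "l = Sup T"
  have "l \<in> T" unfolding l_def using T0 \<open>closed T\<close> \<open>bdd_above T\<close> closed_contains_Sup by blast
  define x1 where "x1 = x0 + l *\<^sub>R n"
  have D1: "D x1 = 0" using \<open>l \<in> T\<close> by (simp add: T_def x1_def)
  have lower: "\<bar>(x - x1) \<bullet> e\<bar> / 2 \<le> D x" for x
    using lower0[of x] by (simp add: x1_def inner_diff_left inner_add_left nn)
  have beyond: "0 < D (x1 + t *\<^sub>R n)" if "0 < t" for t
  proof -
    have "D (x1 + t *\<^sub>R n) \<noteq> 0"
    proof
      assume "D (x1 + t *\<^sub>R n) = 0"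
      then have "l + t \<in> T" using \<open>l \<in> T\<close> that by (simp add: T_def x1_def algebra_simps)
      then have "l + t \<le> l" unfolding l_def using \<open>bdd_above T\<close> cSup_upper by blast
      then show False using that by simp
    qed
    moreover have "0 \<le> D (x1 + t *\<^sub>R n)"
      using lower[of "x1 + t *\<^sub>R n"] by (meson abs_ge_zero divide_nonneg_pos order_trans zero_less_numeral)
    ultimately show ?thesis by simp
  qed
  obtain R where R: "0 < R" "\<And>x. x \<in> S \<Longrightarrow> (x - x1) \<bullet> n \<le> R * E"
  proof -
    have "compact ((\<lambda>x. (x - x1) \<bullet> n) ` S)"
      by (intro compact_continuous_image S continuous_intros)
    then have "bounded ((\<lambda>x. (x - x1) \<bullet> n) ` S)" by (rule compact_imp_bounded)
    then obtain b where b: "\<And>x. x \<in> S \<Longrightarrow> \<bar>(x - x1) \<bullet> n\<bar> \<le> b"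
      by (auto simp: bounded_iff)
    show thesis
    proof (rule that[of "(\<bar>b\<bar> + 1) / E"])
      show "(x - x1) \<bullet> n \<le> (\<bar>b\<bar> + 1) / E * E" if "x \<in> S" for x using b[OF that] E by simp
    qed (use E in simp)
  qed
  \<comment> \<open>Small enough for the final comparison of areas to fail; see \<open>rE\<close>.\<close>
  define r where "r = E / (6 * (\<bar>\<Lambda>\<bar> + 1))"
  have r: "0 < r" using E by (simp add: r_def)
  have rE: "32 * \<Lambda> * r^2 < E^2"
  proof -
    have "32 * \<Lambda> * r^2 \<le> 32 * (\<bar>\<Lambda>\<bar> + 1) * r^2" by (intro mult_right_mono) auto
    also have "\<dots> \<le> 32 * (\<bar>\<Lambda>\<bar> + 1)^2 * r^2"
      by (intro mult_right_mono mult_left_mono) (auto simp: power2_eq_square algebra_simps)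
    also have "\<dots> = 32 * ((\<bar>\<Lambda>\<bar> + 1) * r)^2" by (simp add: power_mult_distrib)
    also have "(\<bar>\<Lambda>\<bar> + 1) * r = E / 6"
    proof -
      have cancel: "k * (E / (6 * k)) = E / 6" if "0 < k" for k :: real using that by simp
      have "0 < \<bar>\<Lambda>\<bar> + 1" by linarith
      from cancel[OF this] show ?thesis unfolding r_def .
    qed
    also have "32 * (E / 6)^2 = 32 / 36 * E^2" by (simp add: power_divide)
    also have "\<dots> < E^2" using E by simp
    finally show ?thesis .
  qed
  obtain c where c: "0 < c" "\<And>x. x \<in> S \<Longrightarrow> r \<le> (x - x1) \<bullet> n \<Longrightarrow> c \<le> D x - \<bar>(x - x1) \<bullet> e\<bar> / 4"
  proof (cases "S \<inter> {x. r \<le> (x - x1) \<bullet> n} = {}")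
    case True
    then show thesis using that[of 1] by auto
  next
    case False
    have cA: "compact (S \<inter> {x. r \<le> (x - x1) \<bullet> n})"
      by (intro compact_Int_closed S closed_Collect_le continuous_intros)
    have "continuous_on (S \<inter> {x. r \<le> (x - x1) \<bullet> n}) (\<lambda>x. D x - \<bar>(x - x1) \<bullet> e\<bar> / 4)"
      by (intro continuous_intros contD) simp
    from continuous_attains_inf[OF cA False this] obtain x where x: "x \<in> S \<inter> {x. r \<le> (x - x1) \<bullet> n}"
      "\<And>y. y \<in> S \<inter> {x. r \<le> (x - x1) \<bullet> n} \<Longrightarrow> D x - \<bar>(x - x1) \<bullet> e\<bar> / 4 \<le> D y - \<bar>(y - x1) \<bullet> e\<bar> / 4"
      by blast
    have "0 < D x - \<bar>(x - x1) \<bullet> e\<bar> / 4"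
    proof (cases "(x - x1) \<bullet> e = 0")
      case True
      define t where "t = (x - x1) \<bullet> n / E"
      have "x = x1 + t *\<^sub>R n"
        by (rule frame_eqI[OF e])
          (use True E in \<open>simp_all add: t_def inner_add_left inner_diff_left nn flip: n_def\<close>)
      moreover have "0 < t" using x(1) r E by (simp add: t_def)
      ultimately show ?thesis using beyond[of t] True by simp
    next
      case False
      then have "0 < \<bar>(x - x1) \<bullet> e\<bar>" by simp
      then show ?thesis using lower[of x] by linarith
    qed
    then show thesis using that x(2) by blast
  qed
  \<comment> \<open>The first bound on \<open>d\<close> keeps the preimages at height less than \<open>r\<close> over \<open>x1\<close>, the second keeps the rectangle of slopes inside \<open>Y\<close>.\<close>
  define Q where "Q = \<bar>(q - m) \<bullet> e\<bar> + E / 2"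
  have Q: "0 < Q" using E by (simp add: Q_def add_nonneg_pos)
  define d where "d = min (c / (2 * R)) (H * E / (4 * Q))"
  have d: "0 < d" using c R H E Q by (simp add: d_def)
  have dR: "d * R < c"
  proof -
    have "d * R \<le> c / (2 * R) * R" using R by (intro mult_right_mono) (auto simp: d_def)
    also have "\<dots> < c" using R c by simp
    finally show ?thesis .
  qed
  have dQ: "d * Q \<le> H * E / 4"
  proof -
    have "d * Q \<le> H * E / (4 * Q) * Q" using Q by (intro mult_right_mono) (auto simp: d_def)
    then show ?thesis using Q by simp
  qed
  define C where "C = rot_box e (m \<bullet> e - E / 4) (m \<bullet> e + E / 4) (m \<bullet> n + d / 2) (m \<bullet> n + d)"
  define B where "B = rot_box e (x1 \<bullet> e - 4 * d * r / E) (x1 \<bullet> e + 4 * d * r / E) (x1 \<bullet> n) (x1 \<bullet> n + r)"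
  have C_iff: "p \<in> C \<longleftrightarrow> \<bar>(p - m) \<bullet> e\<bar> \<le> E / 4 \<and> d / 2 \<le> (p - m) \<bullet> n \<and> (p - m) \<bullet> n \<le> d" for p
    unfolding C_def rot_box_def mem_Collect_eq inner_diff_left abs_le_iff n_def[symmetric]
    by (intro iffI conjI; elim conjE; linarith)
  have B_iff: "x \<in> B \<longleftrightarrow> \<bar>(x - x1) \<bullet> e\<bar> \<le> 4 * d * r / E \<and> 0 \<le> (x - x1) \<bullet> n \<and> (x - x1) \<bullet> n \<le> r" for x
    unfolding B_def rot_box_def mem_Collect_eq inner_diff_left abs_le_iff n_def[symmetric]
    by (intro iffI conjI; elim conjE; linarith)
  have C_Y: "C \<subseteq> Y"
  proof
    fix p assume p: "p \<in> C"
    \<comment> \<open>Write \<open>p\<close> as a convex combination of \<open>q\<close>, which is interior to \<open>Y\<close>, and a point \<open>z\<close> of the segment of slopes.\<close>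
    define s where "s = (p - m) \<bullet> n / H"
    have s0: "0 < s" using p d H by (auto simp: C_iff s_def)
    have sQ: "s * Q \<le> E / 4"
    proof -
      have "s \<le> d / H" unfolding s_def using p H by (intro divide_right_mono) (auto simp: C_iff)
      then have "s * Q \<le> d / H * Q" using Q by (intro mult_right_mono) auto
      also have "\<dots> = d * Q / H" by simp
      also have "\<dots> \<le> E / 4" using dQ H by (simp add: field_simps)
      finally show ?thesis .
    qed
    have "s * (E / 2) \<le> s * Q" using s0 by (simp add: Q_def)
    then have "s * E \<le> 1 / 2 * E" using sQ by linarith
    then have s1: "s \<le> 1 / 2" using E by (simp only: mult_le_cancel_right_pos)
    define a where "a = ((p - m) \<bullet> e - s * ((q - m) \<bullet> e)) / ((1 - s) * E)"
    have "\<bar>(p - m) \<bullet> e - s * ((q - m) \<bullet> e)\<bar> \<le> E / 4 + s * \<bar>(q - m) \<bullet> e\<bar>"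
      using p s0 by (auto simp: C_iff abs_mult intro!: order_trans[OF abs_triangle_ineq4])
    also have "\<dots> \<le> (1 - s) * E / 2" using sQ by (simp add: Q_def algebra_simps)
    finally have "\<bar>a\<bar> \<le> 1 / 2" using s1 E
      by (simp add: a_def abs_mult divide_le_eq)
    define z where "z = m + a *\<^sub>R e"
    have z_eq: "z = (1/2 - a) *\<^sub>R (m - (1/2) *\<^sub>R e) + (1/2 + a) *\<^sub>R (m + (1/2) *\<^sub>R e)"
      by (simp add: z_def vec_eq_iff) (simp add: field_simps)
    have "0 \<le> 1/2 - a" "0 \<le> 1/2 + a" using \<open>\<bar>a\<bar> \<le> 1 / 2\<close> by linarith+
    then have z: "z \<in> closure Y"
      unfolding z_eq using me sub[of x0] by (intro convexD[OF convex_closure[OF Y(2)]]) auto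
    have aE: "(1 - s) * (a * E) = (p - m) \<bullet> e - s * ((q - m) \<bullet> e)" using s1 E by (simp add: a_def)
    have sH: "s * H = (p - m) \<bullet> n" using H by (simp add: s_def)
    have "p = z - s *\<^sub>R (z - q)"
    proof (rule frame_eqI[OF e])
      have "(z - s *\<^sub>R (z - q)) \<bullet> e = m \<bullet> e + (1 - s) * (a * E) + s * ((q - m) \<bullet> e)"
        by (simp add: z_def inner_diff_left inner_add_left E_def algebra_simps)
      then show "p \<bullet> e = (z - s *\<^sub>R (z - q)) \<bullet> e" by (simp add: aE inner_diff_left)
      have "(z - s *\<^sub>R (z - q)) \<bullet> n = m \<bullet> n + s * H"
        by (simp add: z_def H_def inner_diff_left inner_add_left nn algebra_simps)
      then show "p \<bullet> quarter_turn e = (z - s *\<^sub>R (z - q)) \<bullet> quarter_turn e"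
        by (simp add: sH inner_diff_left flip: n_def)
    qed
    moreover have "z - s *\<^sub>R (z - q) \<in> interior Y"
      using mem_interior_closure_convex_shrink[of Y q z s] Y q z s0 s1 by (simp add: interior_open)
    ultimately show "p \<in> Y" using Y by (simp add: interior_open)
  qed
  have catch: "x \<in> B" if x: "x \<in> S" and p: "p \<in> C" "p \<in> subgrad u x" for x p
  proof -
    define z where "z = x - x1"
    define k where "k = (p - m) \<bullet> n"
    have k: "d / 2 \<le> k" "k \<le> d" using p by (auto simp: C_iff k_def)
    have "D x \<le> (p - m) \<bullet> z" using subD[OF p(2), of x1] D1 by (simp add: z_def inner_diff_right)
    moreover have "E * ((p - m) \<bullet> z) \<le> E / 4 * \<bar>z \<bullet> e\<bar> + k * (z \<bullet> n)"
    proof -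
      have "((p - m) \<bullet> e) * (z \<bullet> e) \<le> \<bar>(p - m) \<bullet> e\<bar> * \<bar>z \<bullet> e\<bar>"
        by (metis abs_ge_self abs_mult)
      also have "\<dots> \<le> E / 4 * \<bar>z \<bullet> e\<bar>" using p by (intro mult_right_mono) (auto simp: C_iff)
      finally show ?thesis unfolding dec k_def by simp
    qed
    then have "(p - m) \<bullet> z \<le> \<bar>z \<bullet> e\<bar> / 4 + k * (z \<bullet> n) / E" using E by (simp add: field_simps)
    ultimately have up: "D x \<le> \<bar>z \<bullet> e\<bar> / 4 + k * (z \<bullet> n) / E" by linarith
    \<comment> \<open>The growth of \<open>D\<close> against its upper bound: this is the cone condition.\<close>
    have zn: "\<bar>z \<bullet> e\<bar> / 4 \<le> k * (z \<bullet> n) / E" using up lower[of x] unfolding z_def by linarith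
    then have "0 \<le> k * (z \<bullet> n) / E" by (meson abs_ge_zero divide_nonneg_pos order_trans zero_less_numeral)
    then have zn0: "0 \<le> z \<bullet> n" using E k d by (simp add: zero_le_divide_iff zero_le_mult_iff)
    have zr: "z \<bullet> n < r"
    proof (rule ccontr)
      assume "\<not> z \<bullet> n < r"
      then have "c \<le> k * (z \<bullet> n) / E" using c(2)[OF x] up unfolding z_def by linarith
      also have "\<dots> \<le> d * (R * E) / E"
        using k zn0 R(2)[OF x] E d by (intro divide_right_mono mult_mono) (auto simp: z_def)
      also have "\<dots> < c" using E dR by simp
      finally show False by simp
    qed
    have "k * (z \<bullet> n) / E \<le> d * r / E"
      using k zn0 zr E d by (intro divide_right_mono mult_mono) auto
    moreover have "4 * d * r / E = 4 * (d * r / E)" by simp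
    ultimately have "\<bar>z \<bullet> e\<bar> \<le> 4 * d * r / E" using zn by linarith
    then show ?thesis using zn0 zr by (simp add: B_iff z_def)
  qed
  have dr: "0 \<le> d * r / E" using d r E by simp
  have C: "compact C" "measure lebesgue C = d / 4"
    unfolding C_def using measure_rot_box[OF e] d E by (simp_all flip: E_def)
  have B: "compact B" "measure lebesgue B = 8 * d * r^2 / E^2"
    unfolding B_def using measure_rot_box[OF e] dr r E
    by (simp_all add: power2_eq_square flip: E_def)
  have "measure lebesgue C \<le> \<Lambda> * measure lebesgue B"
    by (rule area[OF C(1) C_Y B(1)]) (rule catch)
  then have "d / 4 \<le> \<Lambda> * (8 * d * r^2 / E^2)" by (simp only: C(2) B(2))
  then have "d * E^2 \<le> d * (32 * \<Lambda> * r^2)" using E by (simp add: field_simps)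
  then show False using d rE by simp
qed

section \<open>Convex functions determined by their slopes\<close>

lemma lsc_eventually_gt:
  assumes "lsc v" "t < v x"
  shows "\<forall>\<^sub>F y in nhds x. t < v y"
proof -
  have "v x \<le> Liminf (at x) v" using assms(1) by (simp add: lsc_def)
  then have "\<forall>\<^sub>F y in at x. t < v y" using assms(2) by (simp add: le_Liminf_iff)
  then show ?thesis using assms(2) by (simp add: eventually_nhds_conv_at)
qed

text \<open>Lower semicontinuity is used through this closedness, which makes nearest-point projection
  onto the epigraph available.\<close>

lemma closed_epigraph:
  fixes v :: "'a::euclidean_space \<Rightarrow> ereal"
  assumes "lsc v" shows "closed {z. v (fst z) \<le> ereal (snd z)}"
proof -
  have "open {z. ereal (snd z) < v (fst z)}"
    unfolding open_subopen[of "{z. ereal (snd z) < v (fst z)}"]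
  proof clarsimp
    fix x t assume "ereal t < v x"
    then obtain c where c: "t < c" "ereal c < v x" using ereal_dense2 by (metis less_ereal.simps(1))
    have "\<forall>\<^sub>F s in nhds t. s < c" using c(1) by (simp add: eventually_nhds_x_imp_x order_tendstoD(2)[OF filterlim_ident])
    then have "\<forall>\<^sub>F z in nhds x \<times>\<^sub>F nhds t. ereal c < v (fst z) \<and> snd z < c"
      using lsc_eventually_gt[OF assms c(2)] by (rule eventually_prodI[rotated])
    then have "\<forall>\<^sub>F z in nhds (x, t). ereal (snd z) < v (fst z)"
      unfolding nhds_prod[symmetric] by (elim eventually_mono) (metis less_ereal.simps(1) less_trans)
    then show "\<exists>T. open T \<and> (x, t) \<in> T \<and> T \<subseteq> {z. ereal (snd z) < v (fst z)}"
      unfolding eventually_nhds by blast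
  qed
  moreover have "- {z. ereal (snd z) < v (fst z)} = {z. v (fst z) \<le> ereal (snd z)}" by auto
  ultimately show ?thesis by (metis closed_Compl)
qed

lemma convex_ereal_real_bound:
  assumes "convex_ereal v" "v x \<le> ereal a" "v y \<le> ereal b" "0 \<le> s" "0 \<le> t" "s + t = 1"
  shows "v (s *\<^sub>R x + t *\<^sub>R y) \<le> ereal (s * a + t * b)"
proof -
  have "v (s *\<^sub>R x + t *\<^sub>R y) \<le> ereal s * v x + ereal t * v y"
    using assms unfolding convex_ereal_def by blast
  also have "\<dots> \<le> ereal s * ereal a + ereal t * ereal b"
    using assms by (intro add_mono ereal_mult_left_mono) auto
  finally show ?thesis by simp
qed

text \<open>Why a convex function whose subgradients are bounded is finite everywhere. Let \<open>w\<close> be the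
  supremum of the supporting affine functions of \<open>v\<close>; its slopes are bounded, so \<open>w\<close> is finite and
  Lipschitz, and \<open>w \<le> v\<close>.

  First, \<open>v = w\<close> where \<open>v\<close> is finite: project a point lying strictly between the graphs of \<open>w\<close>
  and \<open>v\<close> onto the epigraph of \<open>v\<close>. If the direction of projection is not horizontal, it yields a
  supporting affine function exceeding \<open>w\<close>; if it is horizontal, it separates the point from the
  domain of \<open>v\<close>.

  Second, the domain is everything: it is closed because \<open>w\<close> is continuous, and at a boundary point
  any multiple of an outer normal could be added to a subgradient, contrary to boundedness.\<close>

lemma subdifferential_nonempty:
  fixes v :: "'a::euclidean_space \<Rightarrow> ereal"
  assumes conv: "convex_ereal v" and "lsc v"
    and ne: "(\<Union>x. subdifferential v x) \<noteq> {}" and bdd: "bounded (\<Union>x. subdifferential v x)"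
  shows "subdifferential v x \<noteq> {}"
proof -
  have ninf: "v y \<noteq> -\<infinity>" for y using conv by (simp add: convex_ereal_def)
  obtain R where R: "0 < R" "\<And>x p. p \<in> subdifferential v x \<Longrightarrow> norm p \<le> R"
    using bdd unfolding bounded_pos by blast
  define A where "A = {(z, p). p \<in> subdifferential v z}"
  define aff where "aff a x = real_of_ereal (v (fst a)) + snd a \<bullet> (x - fst a)" for a x
  have A_ne: "A \<noteq> {}" using ne by (auto simp: A_def)
  have minorant: "ereal (aff a x) \<le> v x" if "a \<in> A" for a x
  proof -
    obtain z p where a: "a = (z, p)" "p \<in> subdifferential v z" using \<open>a \<in> A\<close> by (auto simp: A_def)
    then obtain r where "v z = ereal r" by (auto simp: subdifferential_def)
    then show ?thesis using a by (auto simp: aff_def subdifferential_def)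
  qed
  have aff_lip: "aff a x \<le> aff a y + R * norm (x - y)" if "a \<in> A" for a x y
  proof -
    have "norm (snd a) \<le> R" using that R(2) by (auto simp: A_def)
    then have "snd a \<bullet> (x - y) \<le> R * norm (x - y)"
      by (meson mult_right_mono norm_cauchy_schwarz norm_ge_zero order_trans)
    moreover have "aff a x = aff a y + snd a \<bullet> (x - y)" by (simp add: aff_def inner_diff_right)
    ultimately show ?thesis by simp
  qed
  obtain xs ps where "ps \<in> subdifferential v xs" using ne by blast
  then obtain vs where vs: "v xs = ereal vs" by (auto simp: subdifferential_def)
  have bda: "bdd_above ((\<lambda>a. aff a x) ` A)" for x
  proof (rule bdd_aboveI2)
    fix a assume a: "a \<in> A"
    show "aff a x \<le> vs + R * norm (x - xs)"
      using minorant[OF a, of xs] aff_lip[OF a, of x xs] vs by simp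
  qed
  define w where "w x = (SUP a\<in>A. aff a x)" for x
  have w_upper: "aff a x \<le> w x" if "a \<in> A" for a x
    unfolding w_def using that bda by (rule cSUP_upper)
  have w_lip: "w x \<le> w y + R * norm (x - y)" for x y
    unfolding w_def[of x]
    by (rule cSUP_least[OF A_ne]) (use aff_lip w_upper in \<open>meson add_right_mono order_trans\<close>)
  define D where "D = {x. v x \<noteq> \<infinity>}"
  have Dreal: "\<exists>r. v y = ereal r" if "y \<in> D" for y
    using that ninf[of y] by (cases "v y") (auto simp: D_def)
  have w_le: "ereal (w x) \<le> v x" for x
  proof (cases "v x")
    case (real r)
    have "w x \<le> r" unfolding w_def using minorant[of _ x] real by (intro cSUP_least[OF A_ne]) auto
    then show ?thesis by (simp add: real)
  qed (use ninf in auto)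
  define F where "F = {z. v (fst z) \<le> ereal (snd z)}"
  have "closed F" unfolding F_def by (rule closed_epigraph) fact
  have "convex F"
    unfolding F_def
    by (rule convexI) (use convex_ereal_real_bound[OF conv] in auto)
  have v_le_w: "v x0 \<le> ereal (w x0)" if x0: "x0 \<in> D" for x0
  proof (rule ccontr)
    assume "\<not> v x0 \<le> ereal (w x0)"
    then obtain t0 where t0: "w x0 < t0" "ereal t0 < v x0"
      using ereal_dense2 by (metis less_ereal.simps(1) not_le)
    have "F \<noteq> {}" using vs by (auto simp: F_def intro!: exI[of _ xs] exI[of _ vs])
    define z where "z = closest_point F (x0, t0)"
    have zF: "z \<in> F" unfolding z_def using \<open>closed F\<close> \<open>F \<noteq> {}\<close> by (rule closest_point_in_set)
    obtain x1 t1 where z: "z = (x1, t1)" by (cases z)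
    have dot: "(x0 - x1) \<bullet> (x - x1) \<le> (t1 - t0) * (t - t1)" if "v x \<le> ereal t" for x t
    proof -
      have "(x, t) \<in> F" using that by (simp add: F_def)
      from closest_point_dot[OF \<open>convex F\<close> \<open>closed F\<close> this, of "(x0, t0)"]
      have "((x0, t0) - (x1, t1)) \<bullet> ((x, t) - (x1, t1)) \<le> 0" unfolding z_def[symmetric] z .
      then show ?thesis by (simp add: algebra_simps)
    qed
    have v1: "v x1 \<le> ereal t1" using zF by (simp add: F_def z)
    have "t0 \<le> t1"
    proof -
      \<comment> \<open>Epigraphs are upward closed, so the nearest point is not below the projected one.\<close>
      have "v x1 \<le> ereal (t1 + 1)" using v1 by (metis ereal_less_eq(3) le_add_same_cancel1 order_trans zero_le_one)
      from dot[OF this] show ?thesis by simp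
    qed
    obtain r0 where r0: "v x0 = ereal r0" using Dreal[OF x0] by blast
    show False
    proof (cases "t0 = t1")
      case True
      have "(x0 - x1) \<bullet> (x0 - x1) \<le> 0" using dot[of x0 r0] r0 True by simp
      then have "x0 - x1 = 0" by (metis inner_eq_zero_iff inner_ge_zero order_antisym)
      then show False using v1 t0(2) True by (simp add: leD)
    next
      case False
      define s where "s = t1 - t0"
      have s: "0 < s" using False \<open>t0 \<le> t1\<close> by (simp add: s_def)
      define p where "p = (1 / s) *\<^sub>R (x0 - x1)"
      have dot': "t1 + p \<bullet> (x - x1) \<le> t" if "v x \<le> ereal t" for x t
        using dot[OF that] s by (simp add: p_def flip: s_def) (simp add: field_simps)
      obtain r1 where r1: "v x1 = ereal r1" using v1 ninf[of x1] by (cases "v x1") auto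
      have "v x1 = ereal t1" using dot'[of x1 r1] r1 v1 by simp
      moreover have "ereal (t1 + p \<bullet> (x - x1)) \<le> v x" for x
        using dot'[of x] ninf[of x] by (cases "v x") auto
      ultimately have "(x1, p) \<in> A" by (simp add: A_def subdifferential_def)
      from w_upper[OF this, of x0] have "t1 + p \<bullet> (x0 - x1) \<le> w x0"
        using \<open>v x1 = ereal t1\<close> by (simp add: aff_def)
      moreover have "0 \<le> p \<bullet> (x0 - x1)" using s by (simp add: p_def)
      ultimately show False using t0(1) \<open>t0 \<le> t1\<close> by simp
    qed
  qed
  have eq_w: "v y = ereal (w y)" if "y \<in> D" for y
    using v_le_w[OF that] w_le[of y] by (rule order_antisym)
  \<comment> \<open>The slope is a limit of slopes of supporting affine functions whose values at \<open>b\<close> tend to \<open>w b\<close>.\<close>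
  have attained: "\<exists>p. norm p \<le> R \<and> (\<forall>x. ereal (w b + p \<bullet> (x - b)) \<le> v x)" for b
  proof -
    have "\<exists>a\<in>A. w b - 1 / real (Suc k) < aff a b" for k
    proof -
      have "w b - 1 / real (Suc k) < (SUP a\<in>A. aff a b)" by (simp add: w_def)
      then show ?thesis unfolding less_cSUP_iff[OF A_ne bda] .
    qed
    then obtain a where a: "\<And>k. a k \<in> A" "\<And>k. w b - 1 / real (Suc k) < aff (a k) b" by metis
    have in_cball: "\<forall>k. snd (a k) \<in> cball 0 R" using a(1) R(2) by (auto simp: A_def case_prod_beta)
    obtain p r where p: "p \<in> cball 0 R" "strict_mono (r :: nat \<Rightarrow> nat)" "((\<lambda>k. snd (a k)) \<circ> r) \<longlonglongrightarrow> p"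
      by (rule seq_compactE[OF compact_imp_seq_compact[OF compact_cball] in_cball])
    have lim: "(\<lambda>k. w b - 1 / real (Suc (r k)) + snd (a (r k)) \<bullet> (x - b)) \<longlonglongrightarrow> w b - 0 + p \<bullet> (x - b)" for x
    proof (intro tendsto_intros)
      show "(\<lambda>k. 1 / real (Suc (r k))) \<longlonglongrightarrow> 0"
        using LIMSEQ_subseq_LIMSEQ[OF LIMSEQ_inverse_real_of_nat p(2)]
        by (simp add: o_def inverse_eq_divide)
    qed (use p(3) in \<open>simp add: o_def\<close>)
    have "ereal (w b + p \<bullet> (x - b)) \<le> v x" for x
    proof (cases "v x")
      case (real c)
      have "w b - 1 / real (Suc (r k)) + snd (a (r k)) \<bullet> (x - b) \<le> c" for k
      proof -
        have "aff (a (r k)) x = aff (a (r k)) b + snd (a (r k)) \<bullet> (x - b)"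
          by (simp add: aff_def inner_diff_right)
        then show ?thesis using a(2)[of "r k"] minorant[OF a(1), of "r k" x] real by simp
      qed
      then have "w b - 0 + p \<bullet> (x - b) \<le> c" using LIMSEQ_le_const2[OF lim] by blast
      then show ?thesis by (simp add: real)
    qed (use ninf in auto)
    then show ?thesis using p(1) by auto
  qed
  have sub: "p \<in> subdifferential v b \<longleftrightarrow> (\<forall>x. ereal (w b + p \<bullet> (x - b)) \<le> v x)" if "b \<in> D" for p b
    using eq_w[OF that] by (simp add: subdifferential_def)
  have "D = UNIV"
  proof (rule ccontr)
    assume "D \<noteq> UNIV"
    then obtain x0 where x0: "x0 \<notin> D" by blast
    have "closed D"
    proof (rule closure_subset_eq[THEN iffD1], rule subsetI, rule ccontr)
      fix b assume b: "b \<in> closure D" "b \<notin> D"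
      then have "ereal (w b + 1) < v b" by (simp add: D_def)
      then have "\<forall>\<^sub>F y in nhds b. ereal (w b + 1) < v y"
        using lsc_eventually_gt \<open>lsc v\<close> by blast
      then obtain e where e: "0 < e" "\<And>y. dist y b < e \<Longrightarrow> ereal (w b + 1) < v y"
        unfolding eventually_nhds_metric by blast
      obtain y where y: "y \<in> D" "dist y b < min e (1 / R)"
        using b(1) e(1) R(1) unfolding closure_approachable by (metis min_less_iff_conj zero_less_divide_1_iff)
      have "w b + 1 < w y" using e(2)[of y] y eq_w[OF y(1)] by simp
      moreover have "R * norm (y - b) < 1" using y(2) R(1) by (simp add: dist_norm field_simps)
      ultimately show False using w_lip[of y b] by simp
    qed
    have "convex D"
    proof (rule convexI)
      fix x y and s t :: real assume xy: "x \<in> D" "y \<in> D" and st: "0 \<le> s" "0 \<le> t" "s + t = 1"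
      then obtain a b where "v x = ereal a" "v y = ereal b" using Dreal by blast
      then have "v (s *\<^sub>R x + t *\<^sub>R y) \<le> ereal (s * a + t * b)"
        using convex_ereal_real_bound[OF conv _ _ st] by simp
      then show "s *\<^sub>R x + t *\<^sub>R y \<in> D" by (auto simp: D_def)
    qed
    have "xs \<in> D" by (simp add: D_def vs)
    define b where "b = closest_point D x0"
    have bD: "b \<in> D" unfolding b_def using \<open>closed D\<close> \<open>xs \<in> D\<close> by (intro closest_point_in_set) auto
    have normal: "(x0 - b) \<bullet> (x - b) \<le> 0" if "x \<in> D" for x
      unfolding b_def by (rule closest_point_dot) fact+
    have nz: "0 < norm (x0 - b)" using bD x0 by auto
    obtain p where p: "norm p \<le> R" "\<And>x. ereal (w b + p \<bullet> (x - b)) \<le> v x" using attained by blast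
    \<comment> \<open>Long enough for the sum with any vector of norm at most \<open>R\<close> to leave the ball of radius \<open>R\<close>.\<close>
    define t where "t = (2 * R + 1) / norm (x0 - b)"
    have t: "0 \<le> t" "t * norm (x0 - b) = 2 * R + 1" using nz R(1) by (simp_all add: t_def)
    have "ereal (w b + (p + t *\<^sub>R (x0 - b)) \<bullet> (x - b)) \<le> v x" for x
    proof (cases "x \<in> D")
      case True
      have "t * ((x0 - b) \<bullet> (x - b)) \<le> 0" using t(1) normal[OF True] by (rule mult_nonneg_nonpos)
      then have "ereal (w b + (p + t *\<^sub>R (x0 - b)) \<bullet> (x - b)) \<le> ereal (w b + p \<bullet> (x - b))"
        by (simp add: inner_add_left)
      then show ?thesis using p(2) order_trans by blast
    qed (simp add: D_def)
    then have "norm (p + t *\<^sub>R (x0 - b)) \<le> R" using sub[OF bD] R(2) by blast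
    moreover have "2 * R + 1 - norm p \<le> norm (p + t *\<^sub>R (x0 - b))"
      using norm_diff_ineq[of "t *\<^sub>R (x0 - b)" p] t by (simp add: add.commute)
    ultimately show False using p(1) by linarith
  qed
  then show ?thesis using attained[of x] sub[of x] by blast
qed

text \<open>Cut the segment from \<open>y\<close> to \<open>z\<close> into \<open>n\<close> equal steps. The bounds for the single steps
  telescope to \<open>(\<xi> z - \<xi> y) \<bullet> (z - y)\<close> divided by \<open>n\<close>.\<close>

lemma monotone_variation_zero:
  fixes \<delta> :: "'a::real_inner \<Rightarrow> real"
  assumes "convex K" and bound: "\<And>y z. y \<in> K \<Longrightarrow> z \<in> K \<Longrightarrow> \<bar>\<delta> z - \<delta> y\<bar> \<le> (\<xi> z - \<xi> y) \<bullet> (z - y)"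
    and yz: "y \<in> K" "z \<in> K"
  shows "\<delta> y = \<delta> z"
proof -
  define c where "c = (\<xi> z - \<xi> y) \<bullet> (z - y)"
  have small: "\<bar>\<delta> z - \<delta> y\<bar> \<le> c / real (Suc n)" for n
  proof -
    define N where "N = Suc n"
    have N: "0 < real N" by (simp add: N_def)
    define q where "q i = y + (real i / real N) *\<^sub>R (z - y)" for i
    have q0: "q 0 = y" and qN: "q N = z" using N by (simp_all add: q_def)
    have qK: "q i \<in> K" if "i \<le> N" for i
    proof -
      have "q i = (1 - real i / real N) *\<^sub>R y + (real i / real N) *\<^sub>R z"
        by (simp add: q_def algebra_simps)
      then show ?thesis using that N yz assms(1) by (simp add: convexD)
    qed
    have step: "q (Suc i) - q i = (1 / real N) *\<^sub>R (z - y)" for i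
      by (simp add: q_def add_divide_distrib scaleR_left_distrib)
    have "\<delta> z - \<delta> y = (\<Sum>i<N. \<delta> (q (Suc i)) - \<delta> (q i))"
      using sum_lessThan_telescope[of "\<lambda>i. \<delta> (q i)" N] by (simp add: q0 qN)
    also have "\<bar>\<dots>\<bar> \<le> (\<Sum>i<N. (\<xi> (q (Suc i)) - \<xi> (q i)) \<bullet> (q (Suc i) - q i))"
      by (rule order_trans[OF sum_abs sum_mono]) (auto intro!: bound qK)
    also have "\<dots> = (\<Sum>i<N. \<xi> (q (Suc i)) - \<xi> (q i)) \<bullet> (z - y) / real N"
      unfolding step by (simp add: inner_sum_left sum_divide_distrib)
    also have "\<dots> = c / real N"
      unfolding sum_lessThan_telescope[of "\<lambda>i. \<xi> (q i)" N] by (simp add: q0 qN c_def)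
    finally show ?thesis by (simp add: N_def)
  qed
  have "(\<lambda>n. c * inverse (real (Suc n))) \<longlonglongrightarrow> c * 0"
    by (intro tendsto_intros LIMSEQ_inverse_real_of_nat)
  then have "\<bar>\<delta> z - \<delta> y\<bar> \<le> c * 0"
    by (rule LIMSEQ_le_const) (use small in \<open>auto simp: divide_inverse\<close>)
  then show ?thesis by simp
qed

text \<open>The comparison takes place on the dual side, where \<open>K\<close> is convex, although the set of
  points \<open>x\<close> at which the slopes are shared may be disconnected. If \<open>y\<close> is a common slope at
  \<open>\<xi> y\<close>, the conjugates of \<open>u\<close> and \<open>v\<close> at \<open>y\<close> are \<open>\<xi> y \<bullet> y - u (\<xi> y)\<close> and
  \<open>\<xi> y \<bullet> y - v (\<xi> y)\<close>. Both have \<open>\<xi> y\<close> as a subgradient at \<open>y\<close>, so their increments from \<open>y\<close>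
  to \<open>z\<close> lie in the same interval, of length \<open>(\<xi> z - \<xi> y) \<bullet> (z - y)\<close>.\<close>

lemma common_subgrads_imp_diff_const:
  fixes u v :: "'a::real_inner \<Rightarrow> real"
  assumes "convex K"
    and common: "\<And>y. y \<in> K \<Longrightarrow> \<exists>x. y \<in> subgrad u x \<and> y \<in> subgrad v x"
    and subu: "\<And>x. \<exists>p\<in>K. p \<in> subgrad u x" and subv: "\<And>x. \<exists>p\<in>K. p \<in> subgrad v x"
  shows "\<exists>c. \<forall>x. v x = u x + c"
proof -
  obtain \<xi> where "\<And>y. y \<in> K \<Longrightarrow> y \<in> subgrad u (\<xi> y) \<and> y \<in> subgrad v (\<xi> y)"
    using common by metis
  then have \<xi>: "u (\<xi> y) + y \<bullet> (x - \<xi> y) \<le> u x" "v (\<xi> y) + y \<bullet> (x - \<xi> y) \<le> v x"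
    if "y \<in> K" for x y using that unfolding mem_subgrad_iff by blast+
  \<comment> \<open>The difference of the two conjugates.\<close>
  define \<delta> where "\<delta> y = v (\<xi> y) - u (\<xi> y)" for y
  obtain y0 where y0: "y0 \<in> K" using subu by blast
  have \<delta>: "\<delta> y = \<delta> y0" if "y \<in> K" for y
  proof (rule monotone_variation_zero[OF assms(1) _ that y0, of _ \<xi>])
    fix y z assume "y \<in> K" "z \<in> K"
    with \<xi>(1)[of y "\<xi> z"] \<xi>(1)[of z "\<xi> y"] \<xi>(2)[of y "\<xi> z"] \<xi>(2)[of z "\<xi> y"]
    show "\<bar>\<delta> z - \<delta> y\<bar> \<le> (\<xi> z - \<xi> y) \<bullet> (z - y)"
      by (simp add: \<delta>_def inner_diff_left inner_diff_right inner_commute abs_le_iff)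
  qed
  have "v x = u x + \<delta> y0" for x
  proof (rule order_antisym)
    obtain p where p: "p \<in> K" "p \<in> subgrad u x" using subu by blast
    have "u x + p \<bullet> (\<xi> p - x) \<le> u (\<xi> p)" using p(2) unfolding mem_subgrad_iff by blast
    then show "u x + \<delta> y0 \<le> v x"
      using \<xi>(2)[OF p(1), of x] \<delta>[OF p(1)] by (simp add: \<delta>_def inner_diff_right)
    obtain p where p: "p \<in> K" "p \<in> subgrad v x" using subv by blast
    have "v x + p \<bullet> (\<xi> p - x) \<le> v (\<xi> p)" using p(2) unfolding mem_subgrad_iff by blast
    then show "v x \<le> u x + \<delta> y0"
      using \<xi>(1)[OF p(1), of x] \<delta>[OF p(1)] by (simp add: \<delta>_def inner_diff_right)
  qed
  then show ?thesis by blast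
qed

section \<open>Gradients with prescribed image measure\<close>

text \<open>Projections of closed sets along a compact factor are closed.\<close>

lemma closed_relation_reaches:
  fixes G :: "('a::euclidean_space \<times> 'a) set"
  assumes "closed G" "compact S"
    and near: "\<And>r. 0 < r \<Longrightarrow> \<exists>x\<in>S. \<exists>q\<in>cball y r. (x, q) \<in> G"
  shows "\<exists>x\<in>S. (x, y) \<in> G"
proof (rule ccontr)
  assume no: "\<not> (\<exists>x\<in>S. (x, y) \<in> G)"
  have "closedin (top_of_set (S \<times> UNIV)) (G \<inter> S \<times> UNIV)"
    using assms(1) by (auto simp: closedin_closed)
  from closedin_compact_projection[OF assms(2) this]
  have "closed {y. \<exists>x. x \<in> S \<and> (x, y) \<in> G \<inter> S \<times> UNIV}" by simp
  also have "{y. \<exists>x. x \<in> S \<and> (x, y) \<in> G \<inter> S \<times> UNIV} = {y. \<exists>x. x \<in> S \<and> (x, y) \<in> G}" by auto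
  finally have "closed {y. \<exists>x. x \<in> S \<and> (x, y) \<in> G}" .
  then have "open (- {y. \<exists>x. x \<in> S \<and> (x, y) \<in> G})" by (rule open_Compl)
  then obtain r where "0 < r" "cball y r \<subseteq> - {y. \<exists>x. x \<in> S \<and> (x, y) \<in> G}"
    using no unfolding open_contains_cball by blast
  then show False using near[of r] by blast
qed

context dual_problem
begin

lemma legendre_at_subgrad:
  assumes cont: "continuous_on UNIV u" and x: "x \<in> S" "y \<in> subgrad u x"
  shows "legendre S u y = x \<bullet> y - u x"
proof (rule antisym)
  show "legendre S u y \<le> x \<bullet> y - u x"
  proof (rule legendre_least[OF S_ne])
    fix z assume "z \<in> S"
    have "u x + y \<bullet> (z - x) \<le> u z" using x(2) unfolding mem_subgrad_iff by blast
    then show "y \<bullet> z - u z \<le> x \<bullet> y - u x" by (simp add: inner_diff_right inner_commute)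
  qed
  have "bounded (u ` S)"
    using cont compact_S by (intro compact_imp_bounded compact_continuous_image) (auto intro: continuous_on_subset)
  from legendre_upper[OF bounded_S this x(1), of y]
  show "x \<bullet> y - u x \<le> legendre S u y" by (simp add: inner_commute)
qed

text \<open>Young's inequality and its equality case. The transform over \<open>S\<close> replaces the full conjugate
  at those slopes \<open>y\<close> that are attained in \<open>S\<close>, which makes the inequality valid at every \<open>z\<close>.\<close>

lemma Young_gap:
  assumes cont: "continuous_on UNIV u" and x: "x \<in> S" "y \<in> subgrad u x"
  shows "0 \<le> u z + legendre S u y - z \<bullet> y"
    and "u z + legendre S u y - z \<bullet> y = 0 \<Longrightarrow> y \<in> subgrad u z"
proof -
  have eq: "legendre S u y = x \<bullet> y - u x" using assms by (rule legendre_at_subgrad)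
  have sub: "u x + y \<bullet> (w - x) \<le> u w" for w using x(2) unfolding mem_subgrad_iff by blast
  show "0 \<le> u z + legendre S u y - z \<bullet> y"
    using sub[of z] eq by (simp add: inner_diff_right inner_commute)
  assume 0: "u z + legendre S u y - z \<bullet> y = 0"
  show "y \<in> subgrad u z"
    unfolding mem_subgrad_iff
  proof
    fix w show "u z + y \<bullet> (w - z) \<le> u w"
      using sub[of w] eq 0 by (simp add: inner_diff_right inner_commute)
  qed
qed

text \<open>Uniqueness of the optimal map. Write \<open>a\<close> and \<open>b\<close> for the conjugates of \<open>u\<close> and \<open>v\<close>. Along
  the own gradient Young's inequality is an equality, so the integrals of \<open>u + a \<circ> P - x \<bullet> P\<close> and
  \<open>v + b \<circ> Q - x \<bullet> Q\<close> vanish. Exchanging \<open>P\<close> and \<open>Q\<close> gives two nonnegative gaps. The maps have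
  the same image measure, so the integrals of \<open>a \<circ> P\<close> and \<open>a \<circ> Q\<close> agree, likewise for \<open>b\<close>, and
  the sum of the integrals of the two gaps is again zero. Hence each gap vanishes almost
  everywhere, which is the equality case of Young's inequality.\<close>

lemma transport_gradients_agree:
  assumes cont: "continuous_on UNIV u" "continuous_on UNIV v"
    and meas: "P \<in> borel_measurable M" "Q \<in> borel_measurable M"
    and push: "distr M borel P = N" "distr M borel Q = N"
    and AE_P: "AE x in M. P x \<in> subgrad u x" and AE_Q: "AE x in M. Q x \<in> subgrad v x"
    and cover: "\<And>y. y \<in> K \<Longrightarrow> \<exists>x\<in>S. y \<in> subgrad u x" "\<And>y. y \<in> K \<Longrightarrow> \<exists>x\<in>S. y \<in> subgrad v x"
  shows "AE x in M. Q x \<in> subgrad u x"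
proof -
  define a where "a = legendre S u"
  define b where "b = legendre S v"
  have bdu: "bounded (u ` S)" and bdv: "bounded (v ` S)"
    using cont compact_S by (auto intro!: compact_imp_bounded compact_continuous_image intro: continuous_on_subset)
  have conta: "continuous_on UNIV a" and contb: "continuous_on UNIV b"
    unfolding a_def b_def using continuous_on_legendre[OF S_ne bounded_S] bdu bdv by blast+
  have inK: "AE x in M. F x \<in> K" if "F \<in> borel_measurable M" "distr M borel F = N" for F
  proof -
    have "AE y in distr M borel F. y \<in> K" unfolding that(2) by (rule AE_K)
    then show ?thesis using that(1) borel_compact[OF compact_K] by (subst (asm) AE_distr_iff) auto
  qed
  have int_comp: "integrable M (\<lambda>x. h (F x))" and eq_comp: "(\<integral>x. h (F x) \<partial>M) = (\<integral>y. h y \<partial>N)"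
    if "F \<in> borel_measurable M" "distr M borel F = N" "continuous_on UNIV h" for F and h :: "'a \<Rightarrow> real"
  proof -
    have "bounded (h ` K)"
      using that(3) compact_K by (intro compact_imp_bounded compact_continuous_image) (auto intro: continuous_on_subset)
    then obtain c where "\<And>y. y \<in> K \<Longrightarrow> \<bar>h y\<bar> \<le> c" by (auto simp: bounded_iff)
    moreover have hm: "h \<in> borel_measurable borel" using that(3) by (rule borel_measurable_continuous_onI)
    ultimately show "integrable M (\<lambda>x. h (F x))"
      using inK[OF that(1,2)] that(1)
      by (intro M.integrable_const_bound[of _ c]) (auto elim!: eventually_mono)
    show "(\<integral>x. h (F x) \<partial>M) = (\<integral>y. h y \<partial>N)"
      using integral_distr[OF that(1) hm] that(2) by simp
  qed
  have int_inner: "integrable M (\<lambda>x. x \<bullet> F x)" if "F \<in> borel_measurable M" "distr M borel F = N" for F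
  proof -
    obtain c where c: "\<And>x. x \<in> S \<Longrightarrow> norm x \<le> c" using bounded_S by (auto simp: bounded_iff)
    obtain d where d: "\<And>y. y \<in> K \<Longrightarrow> norm y \<le> d" using bounded_K by (auto simp: bounded_iff)
    have "AE x in M. norm (x \<bullet> F x) \<le> c * d"
      using AE_S inK[OF that]
    proof eventually_elim
      case (elim x)
      have "norm (x \<bullet> F x) \<le> norm x * norm (F x)" by (simp add: Cauchy_Schwarz_ineq2)
      also have "\<dots> \<le> c * d" using elim c d by (intro mult_mono) (auto intro: order_trans[OF norm_ge_zero])
      finally show ?case .
    qed
    moreover have "(\<lambda>x. x \<bullet> F x) \<in> borel_measurable M"
      using that(1) by (intro borel_measurable_inner) (auto simp: measurable_cong_sets[OF sets_M refl])
    ultimately show ?thesis by (intro M.integrable_const_bound)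
  qed
  note int = integrable_continuous_M[OF cont(1)] integrable_continuous_M[OF cont(2)]
    int_comp[OF meas(1) push(1) conta] int_comp[OF meas(2) push(2) conta]
    int_comp[OF meas(1) push(1) contb] int_comp[OF meas(2) push(2) contb]
    int_inner[OF meas(1) push(1)] int_inner[OF meas(2) push(2)]
  define g where "g x = u x + a (Q x) - x \<bullet> Q x" for x
  define h where "h x = v x + b (P x) - x \<bullet> P x" for x
  have int_g: "integrable M g" and int_h: "integrable M h"
    unfolding g_def h_def by (intro Bochner_Integration.integrable_add Bochner_Integration.integrable_diff int)+
  have g0: "AE x in M. 0 \<le> g x"
    using inK[OF meas(2) push(2)]
    by eventually_elim (use cover(1) Young_gap(1)[OF cont(1)] in \<open>auto simp: g_def a_def\<close>)
  have h0: "AE x in M. 0 \<le> h x"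
    using inK[OF meas(1) push(1)]
    by eventually_elim (use cover(2) Young_gap(1)[OF cont(2)] in \<open>auto simp: h_def b_def\<close>)
  have "(\<integral>x. u x + a (P x) - x \<bullet> P x \<partial>M) = (\<integral>x. 0 \<partial>M)"
    by (rule integral_cong_AE)
      (use borel_measurable_integrable[OF int(1)] borel_measurable_integrable[OF int(3)]
         borel_measurable_integrable[OF int(7)] AE_S AE_P legendre_at_subgrad[OF cont(1)]
       in \<open>auto simp: a_def\<close>)
  then have P0: "(\<integral>x. u x \<partial>M) + (\<integral>x. a (P x) \<partial>M) = (\<integral>x. x \<bullet> P x \<partial>M)"
    by (simp add: int)
  have "(\<integral>x. v x + b (Q x) - x \<bullet> Q x \<partial>M) = (\<integral>x. 0 \<partial>M)"
    by (rule integral_cong_AE)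
      (use borel_measurable_integrable[OF int(2)] borel_measurable_integrable[OF int(6)]
         borel_measurable_integrable[OF int(8)] AE_S AE_Q legendre_at_subgrad[OF cont(2)]
       in \<open>auto simp: b_def\<close>)
  then have Q0: "(\<integral>x. v x \<partial>M) + (\<integral>x. b (Q x) \<partial>M) = (\<integral>x. x \<bullet> Q x \<partial>M)"
    by (simp add: int)
  have "(\<integral>x. g x \<partial>M) + (\<integral>x. h x \<partial>M) = 0"
    using P0 Q0 eq_comp[OF meas(1) push(1) conta] eq_comp[OF meas(2) push(2) conta]
      eq_comp[OF meas(1) push(1) contb] eq_comp[OF meas(2) push(2) contb]
    by (simp add: g_def h_def int)
  moreover have "0 \<le> (\<integral>x. g x \<partial>M)" "0 \<le> (\<integral>x. h x \<partial>M)"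
    using g0 h0 by (auto intro: integral_nonneg_AE)
  ultimately have "(\<integral>x. g x \<partial>M) = 0" by linarith
  then have "AE x in M. g x = 0" using integral_nonneg_eq_0_iff_AE[OF int_g g0] by simp
  with inK[OF meas(2) push(2)] show ?thesis
  proof eventually_elim
    case (elim x)
    then show ?case using cover(1) Young_gap(2)[OF cont(1)] by (auto simp: g_def a_def)
  qed
qed

text \<open>An inequality on closed sets passes to open sets by exhaustion from inside, and complements
  reverse it because both measures have mass one.\<close>

lemma pushforward_eqI:
  assumes "P \<in> borel_measurable M"
    and le: "\<And>C. closed C \<Longrightarrow> measure N C \<le> measure (distr M borel P) C"
  shows "distr M borel P = N"
proof -
  interpret D: prob_space "distr M borel P" using assms(1) by (rule M.prob_space_distr)
  have open_le: "measure N U \<le> measure (distr M borel P) U" if "open U" for U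
  proof -
    define C where "C n = {x. 1 / real (Suc n) \<le> setdist {x} (- U)}" for n
    show ?thesis
    proof (cases "U = UNIV")
      case True
      then show ?thesis using D.prob_space N.prob_le_1 by (metis space_borel space_distr)
    next
      case False
      have cl: "closed (C n)" for n
        unfolding C_def by (intro closed_Collect_le continuous_intros continuous_on_setdist)
      have sub: "C n \<subseteq> U" for n
      proof
        fix x assume x: "x \<in> C n"
        show "x \<in> U"
        proof (rule ccontr)
          assume "x \<notin> U"
          then have "setdist {x} (- U) = 0" by (simp add: setdist_sing_in_set)
          then show False using x by (simp add: C_def)
        qed
      qed
      have un: "(\<Union>n. C n) = U"
      proof (intro equalityI subsetI)
        fix x assume "x \<in> U"
        then have "setdist {x} (- U) \<noteq> 0"
          using that False by (auto simp: setdist_eq_0_sing_1 closure_complement interior_open)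
        then have "0 < setdist {x} (- U)" by (simp add: order_less_le)
        then obtain n where "1 / real (Suc n) < setdist {x} (- U)"
          using reals_Archimedean by (metis inverse_eq_divide)
        then show "x \<in> (\<Union>n. C n)" by (auto simp: C_def intro: less_imp_le)
      qed (use sub in blast)
      have inc: "incseq C"
      proof (rule incseq_SucI)
        fix n
        have "1 / real (Suc (Suc n)) \<le> 1 / real (Suc n)" by (simp add: field_simps)
        then show "C n \<subseteq> C (Suc n)" by (auto simp: C_def)
      qed
      have "(\<lambda>n. measure N (C n)) \<longlonglongrightarrow> measure N (\<Union>n. C n)"
        by (rule N.finite_Lim_measure_incseq) (use cl inc in \<open>auto simp: sets_N\<close>)
      then have "measure N (\<Union>n. C n) \<le> measure (distr M borel P) U"
      proof (rule LIMSEQ_le_const2)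
        show "\<exists>k. \<forall>n\<ge>k. measure N (C n) \<le> measure (distr M borel P) U"
          using order_trans[OF le[OF cl] D.finite_measure_mono[OF sub]] that by simp
      qed
      then show ?thesis by (simp add: un)
    qed
  qed
  have eq: "measure (distr M borel P) C = measure N C" if "closed C" for C
  proof -
    have "measure N (- C) \<le> measure (distr M borel P) (- C)" using that by (intro open_le) (simp add: open_Compl)
    moreover have "measure N (- C) = 1 - measure N C" "measure (distr M borel P) (- C) = 1 - measure (distr M borel P) C"
      using N.prob_compl[of C] D.prob_compl[of C] that sets_eq_imp_space_eq[OF sets_N]
      by (auto simp: sets_N Compl_eq_Diff_UNIV)
    ultimately show ?thesis using le[OF that] by linarith
  qed
  show ?thesis
  proof (rule measure_eqI_generator_eq[where E = "Collect closed" and \<Omega> = UNIV and A = "\<lambda>_. UNIV"])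
    show "emeasure (distr M borel P) X = emeasure N X" if "X \<in> Collect closed" for X
      using eq[of X] that by (simp add: D.emeasure_eq_measure N.emeasure_eq_measure)
    show "sets (distr M borel P) = sigma_sets UNIV (Collect closed)"
      by (simp add: borel_eq_closed)
    show "sets N = sigma_sets UNIV (Collect closed)"
      by (simp add: sets_N borel_eq_closed)
  qed (auto simp: Int_stable_def)
qed

end

text \<open>Almost every pair \<open>(x, Q x)\<close> lies in the closed relation \<open>G\<close> and the image measure charges
  every ball around \<open>y\<close>, so pairs of \<open>G\<close> with \<open>x\<close> in \<open>S\<close> accumulate over \<open>y\<close>.\<close>

lemma (in dual_problem) graph_covers_support:
  assumes "closed G" and meas: "Q \<in> borel_measurable M" and push: "distr M borel Q = N"
    and AE_G: "AE x in M. (x, Q x) \<in> G"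
    and support: "\<And>r. 0 < r \<Longrightarrow> 0 < measure N (cball y r)"
  shows "\<exists>x\<in>S. (x, y) \<in> G"
proof (rule closed_relation_reaches[OF assms(1) compact_S])
  fix r :: real assume "0 < r"
  show "\<exists>x\<in>S. \<exists>q\<in>cball y r. (x, q) \<in> G"
  proof (rule ccontr)
    assume no: "\<not> (\<exists>x\<in>S. \<exists>q\<in>cball y r. (x, q) \<in> G)"
    have "AE x in M. Q x \<notin> cball y r"
      using AE_S AE_G by eventually_elim (use no in blast)
    then have "AE q in distr M borel Q. q \<notin> cball y r"
      using meas by (subst AE_distr_iff) auto
    then have "measure N (cball y r) = 0"
      unfolding push by (subst N.prob_eq_0) (auto simp: sets_N)
    then show False using support[OF \<open>0 < r\<close>] by simp
  qed
qed

section \<open>Measures with bounded densities\<close>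

lemma
  fixes S :: "'a::euclidean_space set"
  assumes S: "open S" and f: "prob_density_on S f"
  shows prob_space_density_measure: "prob_space (density_measure S f)"
    and sets_density_measure: "sets (density_measure S f) = sets borel"
    and AE_density_measure: "AE x in density_measure S f. x \<in> S"
    and density_measure_le: "AE x in lebesgue_on S. f x \<le> c \<Longrightarrow> A \<in> sets borel \<Longrightarrow>
        emeasure (density_measure S f) A \<le> ennreal c * emeasure lebesgue A"
    and density_measure_ge: "AE x in lebesgue_on S. c \<le> f x \<Longrightarrow> A \<in> sets borel \<Longrightarrow> A \<subseteq> S \<Longrightarrow>
        ennreal c * emeasure lebesgue A \<le> emeasure (density_measure S f) A"
proof -
  have Sl: "S \<in> sets lebesgue" using S by auto
  have fm: "f \<in> borel_measurable (lebesgue_on S)" and f1: "(\<integral>\<^sup>+x. ennreal (f x) \<partial>lebesgue_on S) = 1"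
    using f by (auto simp: prob_density_on_def)
  have m: "(\<lambda>x. ennreal (f x) * indicator S x) \<in> borel_measurable lebesgue"
    using borel_measurable_restrict_space_iff_ennreal[of S lebesgue "\<lambda>x. ennreal (f x)"] Sl fm by auto
  show sets: "sets (density_measure S f) = sets borel" by (simp add: density_measure_def)
  have em: "emeasure (density_measure S f) A = (\<integral>\<^sup>+x. ennreal (f x) * indicator S x * indicator A x \<partial>lebesgue)"
    if "A \<in> sets borel" for A
  proof -
    have "A \<in> sets lebesgue" using that by auto
    then show ?thesis unfolding density_measure_def
      using that m by (subst emeasure_distr) (auto simp: emeasure_density intro: measurable_completion)
  qed
  show "prob_space (density_measure S f)"
  proof
    have "space (density_measure S f) = UNIV" by (simp add: density_measure_def)
    then show "emeasure (density_measure S f) (space (density_measure S f)) = 1"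
      using em[of UNIV] f1 Sl by (simp add: nn_integral_restrict_space)
  qed
  show "AE x in density_measure S f. x \<in> S"
  proof (rule AE_I[of _ _ "- S"])
    have "- S \<in> sets borel" using S by auto
    then have "emeasure (density_measure S f) (- S) = (\<integral>\<^sup>+x. 0 \<partial>(lebesgue :: 'a measure))"
      unfolding em[OF \<open>- S \<in> sets borel\<close>] by (intro nn_integral_cong) (auto simp: indicator_def)
    then show "emeasure (density_measure S f) (- S) = 0" by simp
  qed (use S sets in auto)
  show "emeasure (density_measure S f) A \<le> ennreal c * emeasure lebesgue A"
    if "AE x in lebesgue_on S. f x \<le> c" "A \<in> sets borel"
  proof -
    have ae: "AE x in lebesgue. x \<in> S \<longrightarrow> f x \<le> c"
      using that(1) Sl by (simp add: AE_restrict_space_iff)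
    have "emeasure (density_measure S f) A \<le> (\<integral>\<^sup>+x. ennreal c * indicator A x \<partial>lebesgue)"
      unfolding em[OF that(2)]
      by (rule nn_integral_mono_AE) (use ae in \<open>auto elim!: eventually_mono simp: indicator_def intro: ennreal_leI\<close>)
    also have "\<dots> = ennreal c * emeasure lebesgue A"
      using that(2) by (intro nn_integral_cmult_indicator) auto
    finally show ?thesis .
  qed
  show "ennreal c * emeasure lebesgue A \<le> emeasure (density_measure S f) A"
    if "AE x in lebesgue_on S. c \<le> f x" "A \<in> sets borel" "A \<subseteq> S"
  proof -
    have ae: "AE x in lebesgue. x \<in> S \<longrightarrow> c \<le> f x"
      using that(1) Sl by (simp add: AE_restrict_space_iff)
    have "ennreal c * emeasure lebesgue A = (\<integral>\<^sup>+x. ennreal c * indicator A x \<partial>lebesgue)"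
      using that(2) by (intro nn_integral_cmult_indicator[symmetric]) auto
    also have "\<dots> \<le> emeasure (density_measure S f) A"
      unfolding em[OF that(2)]
      by (rule nn_integral_mono_AE)
        (use ae that(3) in \<open>auto elim!: eventually_mono simp: indicator_def intro: ennreal_leI\<close>)
    finally show ?thesis .
  qed
qed

section \<open>Existence, uniqueness and regularity\<close>

theorem proposition3p1:
  fixes X Y :: "(real^2) set" and f g :: "real^2 \<Rightarrow> real" and lam :: real
  assumes "X \<noteq> {}" "bounded X" "open X"
    and "Y \<noteq> {}" "bounded Y" "open Y" "convex Y"
    and "prob_density_on X f" "prob_density_on Y g"
    and "lam > 0"
    and "AE x in lebesgue_on X. 1 / lam \<le> f x \<and> f x \<le> lam"
    and "AE y in lebesgue_on Y. 1 / lam \<le> g y \<and> g y \<le> lam"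
  shows "\<exists>u :: real^2 \<Rightarrow> ereal.
           brenier_solution (density_measure X f) (density_measure Y g) u \<and>
           (\<Union>x. subdifferential u x) = closure Y \<and>
           (\<forall>v. brenier_solution (density_measure X f) (density_measure Y g) v \<and>
                (\<Union>x. subdifferential v x) = closure Y \<longrightarrow>
                (\<exists>c::real. \<forall>x. v x = u x + ereal c)) \<and>
           C1_ereal u"
proof -
  define M where "M = density_measure X f"
  define N where "N = density_measure Y g"
  define S where "S = closure X"
  define K where "K = closure Y"
  have SX: "X \<subseteq> S" and KY: "Y \<subseteq> K" by (simp_all add: S_def K_def closure_subset)
  have compact_K: "compact K" and convex_K: "convex K" and K_ne: "K \<noteq> {}"
    using assms by (simp_all add: K_def compact_closure convex_closure)
  interpret dual_problem M N S K
  proof (intro dual_problem.intro dual_problem_axioms.intro)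
    show "prob_space M" "prob_space N" "sets M = sets borel" "sets N = sets borel"
      unfolding M_def N_def using assms prob_space_density_measure sets_density_measure by blast+
    show "compact S" "S \<noteq> {}" using assms by (simp_all add: S_def compact_closure)
    show "compact K" "K \<noteq> {}" by fact+
    show "AE x in M. x \<in> S"
      using AE_density_measure[OF \<open>open X\<close> \<open>prob_density_on X f\<close>] SX
      unfolding M_def by (auto elim!: eventually_mono)
    show "AE y in N. y \<in> K"
      using AE_density_measure[OF \<open>open Y\<close> \<open>prob_density_on Y g\<close>] KY
      unfolding N_def by (auto elim!: eventually_mono)
  qed
  have M_le: "measure M B \<le> lam * measure lebesgue B" if "compact B" for B
  proof -
    have "AE x in lebesgue_on X. f x \<le> lam" using assms(11) by (auto elim!: eventually_mono)
    from density_measure_le[OF \<open>open X\<close> \<open>prob_density_on X f\<close> this borel_compact[OF that]]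
    have "ennreal (measure M B) \<le> ennreal lam * ennreal (measure lebesgue B)"
      using that by (simp add: M_def[symmetric] M.emeasure_eq_measure emeasure_eq_measure2 lmeasurable_compact)
    then show ?thesis using \<open>lam > 0\<close> by (simp flip: ennreal_mult)
  qed
  have N_ge: "measure lebesgue C \<le> lam * measure N C" if "compact C" "C \<subseteq> Y" for C
  proof -
    have "AE x in lebesgue_on Y. 1 / lam \<le> g x" using assms(12) by (auto elim!: eventually_mono)
    from density_measure_ge[OF \<open>open Y\<close> \<open>prob_density_on Y g\<close> this borel_compact[OF that(1)] that(2)]
    have "ennreal (1 / lam) * ennreal (measure lebesgue C) \<le> ennreal (measure N C)"
      using that by (simp add: N_def[symmetric] N.emeasure_eq_measure emeasure_eq_measure2 lmeasurable_compact)
    then have "1 / lam * measure lebesgue C \<le> measure N C" using \<open>lam > 0\<close> by (simp flip: ennreal_mult)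
    then show ?thesis using \<open>lam > 0\<close> by (simp add: field_simps)
  qed
  have support: "0 < measure N (cball y r)" if y: "y \<in> K" "0 < r" for y r
  proof -
    obtain y' where y': "y' \<in> Y" "dist y' y < r" using y unfolding K_def closure_approachable by blast
    then have "y' \<in> Y \<inter> ball y r" by (simp add: dist_commute)
    then obtain s where s: "0 < s" "cball y' s \<subseteq> Y \<inter> ball y r"
      using \<open>open Y\<close> open_contains_cball[of "Y \<inter> ball y r"] by (meson open_Int open_ball)
    have "0 < measure lebesgue (cball y' s)" using content_cball_pos[OF s(1), of y'] by simp
    also have "\<dots> \<le> lam * measure N (cball y' s)" using s by (intro N_ge) auto
    also have "\<dots> \<le> lam * measure N (cball y r)"
      using s \<open>lam > 0\<close> ball_subset_cball[of y r]
      by (intro mult_left_mono N.finite_measure_mono) (auto simp: sets_N)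
    finally show ?thesis using \<open>lam > 0\<close> by (simp add: zero_less_mult_iff)
  qed
  obtain \<phi> where cont_\<phi>: "continuous_on K \<phi>"
    and opt: "\<And>C. closed C \<Longrightarrow>
      measure N C \<le> measure M {x\<in>S. \<exists>y\<in>C \<inter> K. legendre K \<phi> x = x \<bullet> y - \<phi> y}"
    using optimal_potential by blast
  define u where "u = legendre K \<phi>"
  have b\<phi>: "bounded (\<phi> ` K)"
    using cont_\<phi> compact_K by (intro compact_imp_bounded compact_continuous_image)
  have cont_u: "continuous_on UNIV u"
    unfolding u_def by (rule continuous_on_legendre[OF K_ne bounded_K b\<phi>])
  have sub_K: "subgrad u x \<subseteq> K" for x
    unfolding u_def by (rule subgrad_legendre_subset[OF compact_K convex_K K_ne b\<phi>])
  have maximizer: "y \<in> subgrad u x" if "y \<in> K" "u x = x \<bullet> y - \<phi> y" for x y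
    using maximizer_in_subgrad_legendre[OF bounded_K b\<phi>] that unfolding u_def by blast
  have sub_ne: "subgrad u x \<noteq> {}" for x
    using legendre_attained[OF compact_K K_ne cont_\<phi>, of x] maximizer unfolding u_def by blast
  have opt': "measure N C \<le> measure M B"
    if "closed C" "B \<in> sets borel" "\<And>x p. \<lbrakk>x \<in> S; p \<in> C; p \<in> subgrad u x\<rbrakk> \<Longrightarrow> x \<in> B" for C B
    using opt[OF that(1)] M.finite_measure_mono[of "{x\<in>S. \<exists>y\<in>C \<inter> K. legendre K \<phi> x = x \<bullet> y - \<phi> y}" B]
      that(2,3) maximizer unfolding sets_M u_def by fastforce
  \<comment> \<open>The weak form of the upper bound on the Monge-Ampere measure of \<open>u\<close>, valid on all of the plane.\<close>
  have area: "measure lebesgue C \<le> (lam * lam) * measure lebesgue B"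
    if "compact C" "C \<subseteq> Y" "compact B" "\<And>x p. \<lbrakk>x \<in> S; p \<in> C; p \<in> subgrad u x\<rbrakk> \<Longrightarrow> x \<in> B" for C B
  proof -
    have "measure lebesgue C \<le> lam * measure N C" using that by (intro N_ge)
    also have "\<dots> \<le> lam * measure M B"
      using opt'[OF compact_imp_closed[OF that(1)] borel_compact[OF that(3)] that(4)] \<open>lam > 0\<close>
      by (intro mult_left_mono) auto
    also have "\<dots> \<le> lam * (lam * measure lebesgue B)"
      using M_le[OF that(3)] \<open>lam > 0\<close> by (intro mult_left_mono) auto
    finally show ?thesis by simp
  qed
  have "\<exists>p. subgrad u x = {p}" for x
    using sub_ne[of x] subgrad_unique_plane[OF cont_u sub_K[unfolded K_def] \<open>open Y\<close> \<open>convex Y\<close> \<open>Y \<noteq> {}\<close> compact_S area]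
    by blast
  then obtain p where p: "\<And>x. subgrad u x = {p x}" by metis
  have pK: "p x \<in> K" for x using sub_K[of x] p[of x] by blast
  note C1 = unique_subgrad_imp_C1[OF cont_u compact_K p pK]
  have grad: "gradient (\<lambda>x. ereal (u x)) = p"
    using gradient_eqI[OF C1(1)] by blast
  have p_meas: "p \<in> borel_measurable M"
    using borel_measurable_continuous_onI[OF C1(2)] by (simp add: measurable_cong_sets[OF sets_M refl])
  have push: "distr M borel p = N"
  proof (rule pushforward_eqI[OF p_meas])
    fix C :: "(real^2) set" assume C: "closed C"
    have "p -` C \<in> sets borel"
      using continuous_closed_vimage[OF C, of p] C1(2) by (auto simp: continuous_on_eq_continuous_at)
    then have "measure N C \<le> measure M (p -` C)" using C p by (intro opt') auto
    then show "measure N C \<le> measure (distr M borel p) C"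
      using C p_meas by (simp add: measure_distr sets_eq_imp_space_eq[OF sets_M])
  qed
  have AE_p: "AE x in M. (x, p x) \<in> {(x, q). q \<in> subgrad u x}" by (simp add: p)
  have cover_u: "\<exists>x\<in>S. y \<in> subgrad u x" if "y \<in> K" for y
    using graph_covers_support[OF closed_subgrad_graph[OF cont_u] p_meas push AE_p support[OF that]] by simp
  have brenier: "brenier_solution M N (\<lambda>x. ereal (u x))"
    unfolding brenier_solution_def grad
    using convex_ereal_of_subgrads[OF sub_ne] lsc_of_continuous[OF cont_u] C1(1) p_meas push by blast
  have range: "(\<Union>x. subgrad u x) = K" using sub_K cover_u by blast
  have "\<exists>c::real. \<forall>x. v x = ereal (u x) + ereal c"
    if v: "brenier_solution M N v" "(\<Union>x. subdifferential v x) = K" for v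
  proof -
    have conv: "convex_ereal v" and lsc: "lsc v" and AE_v: "AE x in M. \<exists>p. has_gradient v x p"
      and Q_meas: "gradient v \<in> borel_measurable M" and Q_push: "distr M borel (gradient v) = N"
      using v(1) by (auto simp: brenier_solution_def)
    \<comment> \<open>In particular \<open>v\<close> is finite everywhere and may be treated as a real function.\<close>
    have v_ne: "subdifferential v x \<noteq> {}" for x
      by (rule subdifferential_nonempty[OF conv lsc]) (use v(2) K_ne bounded_K in auto)
    define w where "w x = real_of_ereal (v x)" for x
    have vw: "v = (\<lambda>x. ereal (w x))"
    proof
      fix x
      have "\<bar>v x\<bar> \<noteq> \<infinity>" using v_ne[of x] by (auto simp: subdifferential_def)
      then show "v x = ereal (w x)" by (simp add: w_def ereal_real)
    qed
    have w_K: "subgrad w x \<subseteq> K" for x using v(2) unfolding vw by blast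
    have w_ne: "subgrad w x \<noteq> {}" for x using v_ne unfolding vw .
    obtain R where "0 < R" "\<And>y. y \<in> K \<Longrightarrow> norm y \<le> R" using bounded_K unfolding bounded_pos by blast
    then have cont_w: "continuous_on UNIV w"
      using w_K w_ne by (intro continuous_of_bounded_subgrads[of R]) (auto, blast)
    have AE_Q: "AE x in M. gradient v x \<in> subgrad w x"
      using AE_v
    proof eventually_elim
      case (elim x)
      then obtain q where q: "has_gradient v x q" by blast
      show ?case
        using has_gradient_imp_subdifferential[OF conv q] gradient_eqI[OF q] unfolding vw by simp
    qed
    then have "AE x in M. (x, gradient v x) \<in> {(x, q). q \<in> subgrad w x}" by simp
    from graph_covers_support[OF closed_subgrad_graph[OF cont_w] Q_meas Q_push this support]
    have cover_w: "\<exists>x\<in>S. y \<in> subgrad w x" if "y \<in> K" for y using that by simp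
    have "AE x in M. p x \<in> subgrad u x" by (simp add: p)
    from transport_gradients_agree[OF cont_u cont_w p_meas Q_meas push Q_push this AE_Q cover_u cover_w]
    have "AE x in M. gradient v x \<in> subgrad u x" by blast
    with AE_Q have AE_both: "AE x in M. (x, gradient v x) \<in>
        {(x, q). q \<in> subgrad u x} \<inter> {(x, q). q \<in> subgrad w x}"
      by eventually_elim simp
    have closed_both: "closed ({(x, q). q \<in> subgrad u x} \<inter> {(x, q). q \<in> subgrad w x})"
      by (intro closed_Int closed_subgrad_graph cont_u cont_w)
    \<comment> \<open>Every point of \<open>K\<close>, not only almost every one, is a common slope.\<close>
    have common: "\<exists>x. y \<in> subgrad u x \<and> y \<in> subgrad w x" if "y \<in> K" for y
      using graph_covers_support[OF closed_both Q_meas Q_push AE_both support[OF that]] by auto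
    have "\<exists>c. \<forall>x. w x = u x + c"
      by (rule common_subgrads_imp_diff_const[OF convex_K common])
        (use sub_ne sub_K w_ne w_K in blast)+
    then show ?thesis unfolding vw by auto
  qed
  moreover have "C1_ereal (\<lambda>x. ereal (u x))"
    unfolding C1_ereal_def grad using C1 by blast
  ultimately show ?thesis
    using brenier range unfolding M_def N_def K_def by blast
qed

end
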